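(* Let $H=H_n$ be any sequence of graphs with $|V(H_n)|\le n$, let $p=p_n\in(0,1)$ with $p=\Omega(1)$, and let $D=D_n\ge1$ be integers with $D=O(1)$. Let $\mathbb{Q}=G(n,p)$ and let $\mathbb{P}$ be the planted-$H$ distribution, and write $d_v=\deg_H(v)$. Then there exists a (sequence of) polynomial(s) of degree at most $D$ that strongly separates $\mathbb{P}$ and $\mathbb{Q}$ if and only if $$\lim_{n\to\infty}\max_{1\le t\le D}\frac{\sum_{v\in V(H)}d_v^t}{n^{\frac{1+t}{2}}\left(\frac{p}{1-p}\right)^{\frac t2}}=\infty .$$ Moreover, if this holds, then choosing (for each $n$) $$t^*\in\arg\max_{1\le t\le D}\frac{\sum_{v\in V(H)}d_v^t}{n^{\frac{1+t}{2}}\left(\frac{p}{1-p}\right)^{\frac t2}},$$ the signed star count $f_{\mathbf{K}_{1,t^*}}$ strongly separates $\mathbb{P}$ and $\mathbb{Q}$.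
   Context: Asymptotics are as $n\to\infty$. $a_n=o(b_n)$ means $a_n/b_n\to0$ (in particular $b_n\neq 0$ for large $n$). $p=\Omega(1)$ means $\liminf_n p_n>0$; $D=O(1)$ means $D_n$ is bounded. Graphs on vertex set $[n]$ are identified with vectors $G=(G_{\{i,j\}})\in\{0,1\}^{\binom n2}$ of edge indicators. $G(n,p)$ is the Erdős–Rényi random graph. Planted subgraph detection task: under the null $\mathbb{Q}=G(n,p)$ one observes $G(n,p)$; under $\mathbb{P}$ one observes the union of $G(n,p)$ with an independent random copy of $H$, chosen uniformly among all labelled copies of $H$ in the complete graph $K_n$ (i.e. the image of $H$ under a uniformly random injection $V(H)\to[n]$). A (sequence of) polynomial(s) $f$ in the $\binom n2$ variables $G_{\{i,j\}}$ strongly separates $\mathbb{P}$ and $\mathbb{Q}$ if $\max\{\sqrt{\mathrm{Var}_{\mathbb{P}}(f)},\sqrt{\mathrm{Var}_{\mathbb{Q}}(f)}\}=o(|\mathbb{E}_{\mathbb{P}}f-\mathbb{E}_{\mathbb{Q}}f|)$. For $S\subseteq\binom{[n]}{2}$, $\chi_S(G)=\prod_{\{i,j\}\in S}\frac{G_{\{i,j\}}-p}{\sqrt{p(1-p)}}$. For a graph $\mathbf{S}$ without isolated vertices, its signed count is $f_{\mathbf{S}}(G)=\sum_{S\subseteq\binom{[n]}{2}:\,S\cong\mathbf{S}}\chi_S(G)$. $\mathbf{K}_{1,t}$ is the star with $t$ edges. *)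

theory Defs
  imports "HOL-Probability.Probability" "HOL-Probability.Product_PMF"
    "HOL-Library.Poly_Mapping" "HOL-Library.Ramsey"
begin

text \<open>A graph is a pair of a vertex set and a set of two-element subsets of it.\<close>

type_synonym 'a ugraph = "'a set \<times> 'a set set"

abbreviation verts :: "'a ugraph \<Rightarrow> 'a set" where "verts H \<equiv> fst H"
abbreviation edges :: "'a ugraph \<Rightarrow> 'a set set" where "edges H \<equiv> snd H"

definition simple_graph :: "'a ugraph \<Rightarrow> bool" where
  "simple_graph H \<longleftrightarrow> finite (verts H) \<and> edges H \<subseteq> nsets (verts H) 2"

definition vdegree :: "'a ugraph \<Rightarrow> 'a \<Rightarrow> nat" where
  "vdegree H v = card {e \<in> edges H. v \<in> e}"

definition graph_iso :: "'a ugraph \<Rightarrow> 'b ugraph \<Rightarrow> bool" where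
  "graph_iso A B \<longleftrightarrow>
     (\<exists>\<phi>. bij_betw \<phi> (verts A) (verts B) \<and> (\<lambda>e. \<phi> ` e) ` edges A = edges B)"

definition star_graph :: "nat \<Rightarrow> nat ugraph" where
  "star_graph t = ({0..t}, {{0, i} |i. i \<in> {1..t}})"

definition pairs :: "nat \<Rightarrow> nat set set" where
  "pairs n = nsets {1..n} 2"

text \<open>A graph on \<open>{1..n}\<close> is identified with its vector of edge indicators, a function
  that is \<open>False\<close> outside \<open>pairs n\<close>.\<close>

type_synonym edge_vec = "nat set \<Rightarrow> bool"

definition erdos_renyi :: "nat \<Rightarrow> real \<Rightarrow> edge_vec pmf" where
  "erdos_renyi n p = Pi_pmf (pairs n) False (\<lambda>_. bernoulli_pmf p)"

definition injections :: "'a set \<Rightarrow> 'b set \<Rightarrow> ('a \<Rightarrow> 'b) set" where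
  "injections A B = {\<phi> \<in> A \<rightarrow>\<^sub>E B. inj_on \<phi> A}"

definition random_copy :: "nat \<Rightarrow> 'a ugraph \<Rightarrow> nat set set pmf" where
  "random_copy n H =
     map_pmf (\<lambda>\<phi>. (\<lambda>e. \<phi> ` e) ` edges H) (pmf_of_set (injections (verts H) {1..n}))"

definition planted :: "nat \<Rightarrow> real \<Rightarrow> 'a ugraph \<Rightarrow> edge_vec pmf" where
  "planted n p H =
     map_pmf (\<lambda>(G, S) e. G e \<or> e \<in> S) (pair_pmf (erdos_renyi n p) (random_copy n H))"

text \<open>Real multivariate polynomials as finitely supported maps from monomials (finitely
  supported exponent vectors) to coefficients.\<close>

type_synonym 'v mpoly = "('v \<Rightarrow>\<^sub>0 nat) \<Rightarrow>\<^sub>0 real"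

definition mpoly_eval :: "'v mpoly \<Rightarrow> ('v \<Rightarrow> real) \<Rightarrow> real" where
  "mpoly_eval f x =
     (\<Sum>m\<in>Poly_Mapping.keys f.
        Poly_Mapping.lookup f m * (\<Prod>v\<in>Poly_Mapping.keys m. x v ^ Poly_Mapping.lookup m v))"

definition mpoly_vars :: "'v mpoly \<Rightarrow> 'v set" where
  "mpoly_vars f = (\<Union>m\<in>Poly_Mapping.keys f. Poly_Mapping.keys m)"

text \<open>The zero polynomial gets total degree 0.\<close>

definition mpoly_degree :: "'v mpoly \<Rightarrow> nat" where
  "mpoly_degree f =
     Max (insert 0 ((\<lambda>m. \<Sum>v\<in>Poly_Mapping.keys m. Poly_Mapping.lookup m v)
            ` Poly_Mapping.keys f))"

definition poly_fun :: "nat set mpoly \<Rightarrow> edge_vec \<Rightarrow> real" where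
  "poly_fun f G = mpoly_eval f (\<lambda>e. of_bool (G e))"

definition fchar :: "real \<Rightarrow> nat set set \<Rightarrow> edge_vec \<Rightarrow> real" where
  "fchar p S G = (\<Prod>e\<in>S. (of_bool (G e) - p) / sqrt (p * (1 - p)))"

text \<open>An edge set \<open>S\<close> is regarded as the graph it spans, with vertex set \<open>\<Union>S\<close>; so the
  definition is meaningful for shapes without isolated vertices.\<close>

definition signed_count :: "nat \<Rightarrow> real \<Rightarrow> 'a ugraph \<Rightarrow> edge_vec \<Rightarrow> real" where
  "signed_count n p A G = (\<Sum>S | S \<subseteq> pairs n \<and> graph_iso (\<Union>S, S) A. fchar p S G)"

text \<open>\<open>a = o(b)\<close> is understood as \<open>a n / b n \<longlonglongrightarrow> 0\<close> with \<open>b n \<noteq> 0\<close> for large \<open>n\<close>.  The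
  second requirement is stated separately because \<open>x / 0 = 0\<close> here, and because the
  Landau set \<open>o(b)\<close> of the library does not impose it.\<close>

definition strongly_separates ::
  "(nat \<Rightarrow> 'g pmf) \<Rightarrow> (nat \<Rightarrow> 'g pmf) \<Rightarrow> (nat \<Rightarrow> 'g \<Rightarrow> real) \<Rightarrow> bool" where
  "strongly_separates P Q f \<longleftrightarrow>
     (let a = (\<lambda>n. max (sqrt (measure_pmf.variance (P n) (f n)))
                       (sqrt (measure_pmf.variance (Q n) (f n))));
          b = (\<lambda>n. \<bar>measure_pmf.expectation (P n) (f n)
                    - measure_pmf.expectation (Q n) (f n)\<bar>)
      in (\<forall>\<^sub>F n in sequentially. b n \<noteq> 0) \<and> (\<lambda>n. a n / b n) \<longlonglongrightarrow> 0)"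

definition star_ratio :: "nat \<Rightarrow> real \<Rightarrow> 'a ugraph \<Rightarrow> nat \<Rightarrow> real" where
  "star_ratio n p H t =
     (\<Sum>v\<in>verts H. real (vdegree H v) ^ t)
       / (real n powr ((1 + real t) / 2) * (p / (1 - p)) powr (real t / 2))"

end

theory Submission imports Defs begin

text \<open>
  Write \<open>\<lambda> = sqrt ((1 - p) / p)\<close>, the value that the normalised edge variable takes on a planted edge;
  it stays bounded because \<open>p\<close> is bounded below.  Put \<open>x\<^sub>v = \<lambda> d\<^sub>v\<close>.  The ratio for \<open>t\<close> is then
  \<open>R\<^sub>t = (\<Sum>v. x\<^sub>v ^ t) / n powr ((1 + t) / 2)\<close>.

  If some polynomial separates, some ratio is large.  The characters \<open>\<chi>\<^sub>S\<close> are orthonormal under the null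
  model, so by Cauchy--Schwarz a polynomial of degree at most \<open>D\<close> satisfies
  \<open>(E\<^sub>P f - E\<^sub>Q f)\<^sup>2 \<le> Var\<^sub>Q f * (\<Sum>S. (E\<^sub>P \<chi>\<^sub>S)\<^sup>2)\<close>, the sum running over \<open>1 \<le> card S \<le> D\<close>
  (\<open>low_degree_advantage\<close>).  Here \<open>E\<^sub>P \<chi>\<^sub>S\<close> is \<open>\<lambda> ^ card S\<close> times the probability that the random copy
  contains \<open>S\<close>, and that probability is at most a constant times the number of homomorphisms from \<open>S\<close> to \<open>H\<close>,
  divided by \<open>n ^ k\<close>, where \<open>k\<close> is the number of vertices of \<open>S\<close>.  Homomorphisms are counted by passing to a
  minimal edge cover of the vertices of \<open>S\<close>: deleting an edge can only create homomorphisms and costs a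
  bounded factor \<open>\<lambda>\<close>, and a minimal edge cover is a vertex-disjoint union of stars.  A star with \<open>t\<close> edges has at
  most \<open>\<Sum>v. d\<^sub>v ^ t\<close> homomorphisms to \<open>H\<close>, so every star component on \<open>t + 1\<close> vertices contributes at most
  \<open>R\<^sub>t * sqrt n ^ (t + 1)\<close> (\<open>homs_bound\<close>).  If all ratios are bounded, this makes \<open>(E\<^sub>P \<chi>\<^sub>S)\<^sup>2\<close> at most of order
  \<open>n powr (- k)\<close>, and there are at most of order \<open>n ^ k\<close> sets \<open>S\<close> on \<open>k\<close> vertices, so the advantage is bounded
  (\<open>advantage_bound\<close>).

  Conversely, let \<open>R\<^sub>t\<close> be large.  Given the planted copy, the signed count of \<open>t\<close>-stars has mean \<open>\<lambda> ^ t\<close> times the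
  number of \<open>t\<close>-stars of \<open>H\<close>.  This does not depend on the copy, so the variance of the count under the planted
  model is the average of its conditional variances.  The mean is at least a constant times
  \<open>R\<^sub>t * sqrt n ^ (t + 1)\<close>, since vertices of degree below \<open>t\<close> contribute only order \<open>n\<close> to \<open>\<Sum>v. x\<^sub>v ^ t\<close>.  A conditional
  covariance of two stars is positive only if they share an edge and all edges outside the intersection
  are planted.  Two such stars with a common centre \<open>v\<close> and \<open>s \<ge> 1\<close> common edges account for \<open>n ^ s * x\<^sub>v ^ (2 * (t - s))\<close>,
  and two stars with distinct centres \<open>v\<close>, \<open>w\<close> share exactly the edge between the centres and account for
  \<open>x\<^sub>v ^ (t - 1) * x\<^sub>w ^ (t - 1)\<close> (\<open>overlap_sum_stars\<close>).  Interpolating each of these powers between the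
  exponent \<open>0\<close> and the full exponent bounds the variance by a constant times
  \<open>K ^ t * n ^ (t + 1) + (\<Sum>v. x\<^sub>v ^ t)\<^sup>2 / K\<close> for every \<open>1 \<le> K \<le> n\<close> (\<open>overlap_power_sums_le\<close>).  Relative to the squared
  mean this is of order \<open>K ^ t / R\<^sub>t\<^sup>2 + 1 / K\<close>, which is small once \<open>K\<close> is a large constant and \<open>R\<^sub>t\<close> is large
  compared with a power of \<open>K\<close>.
\<close>

section \<open>The planted model conditionally on the planted copy\<close>

text \<open>The value of \<open>(G e - p) / sqrt (p * (1 - p))\<close> at \<open>G e = 1\<close>, so the mean of this variable on a planted
  edge.\<close>

definition edge_signal :: "real \<Rightarrow> real" where
  "edge_signal p = sqrt ((1 - p) / p)"

definition overlay :: "nat set set \<Rightarrow> edge_vec \<Rightarrow> edge_vec" where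
  "overlay E G = (\<lambda>e. G e \<or> e \<in> E)"

lemma edge_signal_pos: "0 < p \<Longrightarrow> p < 1 \<Longrightarrow> edge_signal p > 0"
  by (simp add: edge_signal_def)

lemma finite_pairs [simp]: "finite (pairs n)"
  by (simp add: pairs_def finite_imp_finite_nsets)

lemma finite_set_erdos_renyi [simp]: "finite (set_pmf (erdos_renyi n p))"
proof -
  have "finite (PiE_dflt (pairs n) False (set_pmf \<circ> (\<lambda>_. bernoulli_pmf p)))"
    by (intro finite_PiE_dflt) (auto intro: finite_subset[of _ "UNIV :: bool set"])
  thus ?thesis
    unfolding erdos_renyi_def by (simp add: set_Pi_pmf)
qed

text \<open>Characters take negative values, so the product formula is needed for functions of arbitrary sign;
  finite supports make everything integrable.\<close>

lemma expectation_prod_Pi_pmf_finite: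
  fixes f :: "'a \<Rightarrow> 'b \<Rightarrow> real"
  assumes A: "finite A" and fin: "\<And>x. x \<in> A \<Longrightarrow> finite (set_pmf (q x))"
  shows "measure_pmf.expectation (Pi_pmf A d q) (\<lambda>y. \<Prod>x\<in>A. f x (y x)) =
           (\<Prod>x\<in>A. measure_pmf.expectation (q x) (f x))"
proof -
  have "finite (PiE_dflt A d (set_pmf \<circ> q))"
    by (intro finite_PiE_dflt) (auto simp: A fin)
  hence fin': "finite (set_pmf (Pi_pmf A d q))"
    using A by (simp add: set_Pi_pmf)
  have ind: "prob_space.indep_vars (measure_pmf (Pi_pmf A d q)) (\<lambda>_. borel)
      (\<lambda>x y. f x (y x)) A"
    by (rule prob_space.indep_vars_compose2[OF measure_pmf.prob_space_axioms
          indep_vars_Pi_pmf[OF A], where Y = f]) simp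
  have "measure_pmf.expectation (Pi_pmf A d q) (\<lambda>y. \<Prod>x\<in>A. f x (y x)) =
      (\<Prod>x\<in>A. measure_pmf.expectation (Pi_pmf A d q) (\<lambda>y. f x (y x)))"
    by (rule prob_space.indep_vars_lebesgue_integral[OF measure_pmf.prob_space_axioms A ind])
       (auto intro: integrable_measure_pmf_finite fin')
  also have "\<dots> = (\<Prod>x\<in>A. measure_pmf.expectation (q x) (f x))"
  proof (rule prod.cong)
    fix x assume x: "x \<in> A"
    have "measure_pmf.expectation (Pi_pmf A d q) (\<lambda>y. f x (y x)) =
      measure_pmf.expectation (map_pmf (\<lambda>y. y x) (Pi_pmf A d q)) (f x)" by simp
    also have "map_pmf (\<lambda>y. y x) (Pi_pmf A d q) = q x"
      using A x by (simp add: Pi_pmf_component)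
    finally show "measure_pmf.expectation (Pi_pmf A d q) (\<lambda>y. f x (y x)) =
      measure_pmf.expectation (q x) (f x)" .
  qed simp
  finally show ?thesis .
qed

lemma expectation_edge:
  fixes p :: real assumes p: "0 < p" "p < 1"
  defines "s \<equiv> sqrt (p * (1 - p))"
  shows "measure_pmf.expectation (bernoulli_pmf p) (\<lambda>b. (of_bool (b \<or> e \<in> E) - p) / s) =
           (if e \<in> E then edge_signal p else 0)" (is ?A)
    and "measure_pmf.expectation (bernoulli_pmf p) (\<lambda>b. ((of_bool (b \<or> e \<in> E) - p) / s)\<^sup>2) =
           (if e \<in> E then (edge_signal p)\<^sup>2 else 1)" (is ?B)
proof -
  have s2: "s\<^sup>2 = p * (1 - p)" and s: "s > 0" using p by (auto simp: s_def)
  have l: "(1 - p) / s = edge_signal p"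
  proof -
    have "(1 - p) / s = sqrt ((1-p)^2) / sqrt (p * (1 - p))" using p by (simp add: s_def)
    also have "\<dots> = sqrt ((1-p)^2 / (p * (1 - p)))" by (simp only: real_sqrt_divide)
    also have "(1-p)^2 / (p * (1 - p)) = (1 - p) / p" using p by (simp add: power2_eq_square)
    finally show ?thesis by (simp add: edge_signal_def)
  qed
  show ?A using p s l by (auto simp: field_simps)
  show ?B
  proof (cases "e \<in> E")
    case True
    then show ?thesis using p s l by simp
  next
    case False
    have "p * ((1 - p) / s)\<^sup>2 + (1 - p) * (p / s)\<^sup>2 = p * (1 - p) * (1 - p + p) / s\<^sup>2"
      by (simp add: power_divide power2_eq_square algebra_simps add_divide_distrib diff_divide_distrib)
    also have "\<dots> = 1" using p s2 by simp
    finally show ?thesis using False p by (simp add: mult.commute)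
  qed
qed

text \<open>Conditionally on the planted edge set \<open>E\<close> the edges are independent, so the expectation factors over
  edges.  A non-planted edge has mean \<open>0\<close> and second moment \<open>1\<close>; a planted edge is deterministic.  Hence a
  non-planted edge in the symmetric difference kills the product, and a common edge gives \<open>1\<close> or
  \<open>(edge_signal p)\<^sup>2\<close>.\<close>

lemma expectation_fchar_overlay_mult:
  assumes p: "0 < p" "p < 1" and S: "S \<subseteq> pairs n" and T: "T \<subseteq> pairs n"
  shows "measure_pmf.expectation (erdos_renyi n p)
           (\<lambda>G. fchar p S (overlay E G) * fchar p T (overlay E G)) =
         (if sym_diff S T \<subseteq> E
          then edge_signal p ^ card (sym_diff S T) * edge_signal p ^ (2 * card (S \<inter> T \<inter> E)) else 0)"
proof -
  define h where "h = (\<lambda>e b. (of_bool (b \<or> e \<in> E) - p) / sqrt (p * (1 - p)))"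
  define k where "k = (\<lambda>e b. if e \<in> S \<inter> T then (h e b)\<^sup>2 else if e \<in> sym_diff S T then h e b else 1)"
  have fin: "finite S" "finite T" using S T finite_subset finite_pairs by blast+
  have pr: "(\<Prod>e\<in>pairs n. if e \<in> A then F e else 1) = (\<Prod>e\<in>A. F e)"
    if "A \<subseteq> pairs n" for A and F :: "nat set \<Rightarrow> real"
    using that by (simp add: prod.inter_restrict[symmetric] Int_absorb1)
  have "fchar p S (overlay E G) * fchar p T (overlay E G) = (\<Prod>e\<in>pairs n. k e (G e))" for G
  proof -
    have "fchar p S (overlay E G) * fchar p T (overlay E G) =
      (\<Prod>e\<in>pairs n. (if e \<in> S then h e (G e) else 1) * (if e \<in> T then h e (G e) else 1))"
      unfolding prod.distrib pr[OF S] pr[OF T] by (simp add: fchar_def h_def overlay_def)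
    also have "\<dots> = (\<Prod>e\<in>pairs n. k e (G e))"
      by (intro prod.cong) (auto simp: k_def power2_eq_square)
    finally show ?thesis .
  qed
  hence "measure_pmf.expectation (erdos_renyi n p)
           (\<lambda>G. fchar p S (overlay E G) * fchar p T (overlay E G)) =
         (\<Prod>e\<in>pairs n. measure_pmf.expectation (bernoulli_pmf p) (k e))"
    unfolding erdos_renyi_def
    by (simp, subst expectation_prod_Pi_pmf_finite) (auto intro: finite_subset[of _ "UNIV :: bool set"])
  also have "\<dots> = (\<Prod>e\<in>pairs n. (if e \<in> S \<inter> T then if e \<in> E then (edge_signal p)\<^sup>2 else 1 else 1) *
      (if e \<in> sym_diff S T then if e \<in> E then edge_signal p else 0 else 1))"
  proof (intro prod.cong refl)
    fix e
    consider "e \<in> S \<inter> T" | "e \<notin> S \<inter> T" "e \<in> sym_diff S T" | "e \<notin> S \<inter> T" "e \<notin> sym_diff S T" by blast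
    then show "measure_pmf.expectation (bernoulli_pmf p) (k e) =
      (if e \<in> S \<inter> T then if e \<in> E then (edge_signal p)\<^sup>2 else 1 else 1) *
      (if e \<in> sym_diff S T then if e \<in> E then edge_signal p else 0 else 1)"
    proof cases
      case 1
      hence "k e = (\<lambda>b. (h e b)\<^sup>2)" by (auto simp: k_def)
      with 1 show ?thesis using expectation_edge(2)[OF p, of e E] by (simp add: h_def)
    next
      case 2
      hence "k e = h e" by (auto simp: k_def)
      hence "measure_pmf.expectation (bernoulli_pmf p) (k e) = (if e \<in> E then edge_signal p else 0)"
        using expectation_edge(1)[OF p, of e E] by (simp only: h_def)
      with 2 show ?thesis by auto
    next
      case 3
      hence "k e = (\<lambda>b. 1)" by (auto simp: k_def)
      moreover have "e \<notin> S" "e \<notin> T" using 3 by auto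
      ultimately show ?thesis by simp
    qed
  qed
  also have "\<dots> = (\<Prod>e\<in>S \<inter> T. if e \<in> E then (edge_signal p)\<^sup>2 else 1) *
      (\<Prod>e\<in>sym_diff S T. if e \<in> E then edge_signal p else 0)"
    unfolding prod.distrib using S T by (subst (1 2) pr) auto
  also have "(\<Prod>e\<in>S \<inter> T. if e \<in> E then (edge_signal p)\<^sup>2 else 1) = edge_signal p ^ (2 * card (S \<inter> T \<inter> E))"
    using fin by (simp add: prod.inter_restrict[symmetric] power_mult)
  also have "(\<Prod>e\<in>sym_diff S T. if e \<in> E then edge_signal p else 0) =
      (if sym_diff S T \<subseteq> E then edge_signal p ^ card (sym_diff S T) else 0)"
  proof (cases "sym_diff S T \<subseteq> E")
    case True
    hence "(\<Prod>e\<in>sym_diff S T. if e \<in> E then edge_signal p else 0) = (\<Prod>e\<in>sym_diff S T. edge_signal p)"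
      by (intro prod.cong) auto
    then show ?thesis using True by simp
  next
    case False
    then show ?thesis using fin by (auto intro!: prod_zero)
  qed
  finally show ?thesis by simp
qed

lemma expectation_fchar_overlay:
  assumes p: "0 < p" "p < 1" and S: "S \<subseteq> pairs n"
  shows "measure_pmf.expectation (erdos_renyi n p) (\<lambda>G. fchar p S (overlay E G)) =
         (if S \<subseteq> E then edge_signal p ^ card S else 0)"
  using expectation_fchar_overlay_mult[OF p S, of "{}" E] by (simp add: fchar_def)

lemma overlay_empty [simp]: "overlay {} G = G"
  by (simp add: overlay_def)

lemma finite_injections [simp]: "finite A \<Longrightarrow> finite B \<Longrightarrow> finite (injections A B)"
  unfolding injections_def by (rule finite_subset[of _ "A \<rightarrow>\<^sub>E B"]) (auto intro: finite_PiE)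

lemma injections_nonempty:
  assumes "finite A" "finite B" "card A \<le> card B"
  shows "injections A B \<noteq> {}"
proof -
  obtain f where f: "f ` A \<subseteq> B" "inj_on f A"
    using card_le_inj[OF assms] by blast
  have "restrict f A \<in> injections A B"
    unfolding injections_def using f by (auto simp: inj_on_def)
  thus ?thesis by blast
qed

lemma finite_set_random_copy [simp]:
  assumes "simple_graph H" "card (verts H) \<le> n"
  shows "finite (set_pmf (random_copy n H))"
  using assms injections_nonempty[of "verts H" "{1..n}"]
  by (auto simp: random_copy_def simple_graph_def)

lemma set_random_copyE:
  assumes H: "simple_graph H" "card (verts H) \<le> n" and E: "E \<in> set_pmf (random_copy n H)"
  obtains \<phi> where "\<phi> \<in> verts H \<rightarrow> {1..n}" "inj_on \<phi> (verts H)" "E = (\<lambda>e. \<phi> ` e) ` edges H"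
    "E \<subseteq> pairs n"
proof -
  have fin: "finite (verts H)" using H by (simp add: simple_graph_def)
  from E obtain \<phi> where \<phi>: "\<phi> \<in> injections (verts H) {1..n}" "E = (\<lambda>e. \<phi> ` e) ` edges H"
    using injections_nonempty[of "verts H" "{1..n}"] H fin
    by (auto simp: random_copy_def)
  have 1: "\<phi> \<in> verts H \<rightarrow> {1..n}" "inj_on \<phi> (verts H)" using \<phi> by (auto simp: injections_def)
  have "E \<subseteq> pairs n"
  proof
    fix e' assume "e' \<in> E"
    then obtain e where e: "e \<in> edges H" "e' = \<phi> ` e" using \<phi> by auto
    hence "e \<subseteq> verts H" "card e = 2" "finite e" using H by (auto simp: simple_graph_def nsets_def)
    thus "e' \<in> pairs n" using 1 e
      by (auto simp: pairs_def nsets_def card_image inj_on_subset[of \<phi> "verts H" e])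
  qed
  with 1 \<phi> that show ?thesis by blast
qed

text \<open>Sampling the copy first turns every expectation under the planted model into an average of
  conditional expectations.\<close>

lemma planted_bind:
  "planted n p H = bind_pmf (random_copy n H) (\<lambda>E. map_pmf (overlay E) (erdos_renyi n p))"
  unfolding planted_def pair_pmf_def map_bind_pmf
  by (subst bind_commute_pmf) (simp add: overlay_def map_pmf_def bind_assoc_pmf bind_return_pmf)

lemma finite_set_planted [simp]:
  assumes "simple_graph H" "card (verts H) \<le> n"
  shows "finite (set_pmf (planted n p H))"
  using assms by (simp add: planted_bind)

lemma expectation_planted:
  fixes g :: "edge_vec \<Rightarrow> real"
  assumes H: "simple_graph H" "card (verts H) \<le> n"
  shows "measure_pmf.expectation (planted n p H) g =
    measure_pmf.expectation (random_copy n H)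
      (\<lambda>E. measure_pmf.expectation (erdos_renyi n p) (\<lambda>G. g (overlay E G)))"
proof -
  have "measure_pmf.expectation (planted n p H) g = (\<Sum>E\<in>set_pmf (random_copy n H).
      pmf (random_copy n H) E *\<^sub>R measure_pmf.expectation (map_pmf (overlay E) (erdos_renyi n p)) g)"
    unfolding planted_bind using H by (intro pmf_expectation_bind) auto
  also have "\<dots> = measure_pmf.expectation (random_copy n H)
      (\<lambda>E. measure_pmf.expectation (erdos_renyi n p) (\<lambda>G. g (overlay E G)))"
    using H by (subst integral_measure_pmf[of "set_pmf (random_copy n H)"]) auto
  finally show ?thesis .
qed

lemma expectation_fchar_planted:
  assumes p: "0 < p" "p < 1" and H: "simple_graph H" "card (verts H) \<le> n" and S: "S \<subseteq> pairs n"
  shows "measure_pmf.expectation (planted n p H) (fchar p S) =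
    edge_signal p ^ card S * measure_pmf.prob (random_copy n H) {E. S \<subseteq> E}"
proof -
  have "measure_pmf.expectation (planted n p H) (fchar p S) =
    measure_pmf.expectation (random_copy n H) (\<lambda>E. edge_signal p ^ card S * indicator {E. S \<subseteq> E} E)"
    unfolding expectation_planted[OF H]
    by (intro arg_cong[of _ _ "measure_pmf.expectation _"] ext)
       (use expectation_fchar_overlay[OF p S] in \<open>simp add: indicator_def\<close>)
  thus ?thesis by simp
qed

section \<open>How often a fixed edge set lies in the random copy\<close>

text \<open>Extensional, so that there are finitely many.  Non-injective homomorphisms are included, because then a
  homomorphism from a disjoint union is the same as one from each part.\<close>

definition homs :: "'b set set \<Rightarrow> 'a ugraph \<Rightarrow> ('b \<Rightarrow> 'a) set" where
  "homs S H = {\<psi> \<in> \<Union>S \<rightarrow>\<^sub>E verts H. \<forall>e\<in>S. \<psi> ` e \<in> edges H}"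

lemma finite_homs: "finite (\<Union>S) \<Longrightarrow> simple_graph H \<Longrightarrow> finite (homs S H)"
  unfolding homs_def simple_graph_def
  by (rule finite_subset[of _ "\<Union>S \<rightarrow>\<^sub>E verts H"]) (auto intro: finite_PiE)

lemma simple_graph_finite_edges: "simple_graph H \<Longrightarrow> finite (edges H)"
  unfolding simple_graph_def using finite_imp_finite_nsets finite_subset by blast

text \<open>A homomorphism is determined by the image \<open>v\<close> of the centre and the images of the edges, each of which is
  one of the \<open>d\<^sub>v\<close> edges at \<open>v\<close>.\<close>

lemma card_homs_star:
  assumes H: "simple_graph H" and S: "finite S" "S \<noteq> {}" "\<And>e. e \<in> S \<Longrightarrow> card e = 2 \<and> a \<in> e"
  shows "card (homs S H) \<le> (\<Sum>v\<in>verts H. vdegree H v ^ card S)"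
proof -
  let ?f = "\<lambda>\<psi>. (\<psi> a, \<lambda>e\<in>S. \<psi> ` e)"
  let ?B = "Sigma (verts H) (\<lambda>v. S \<rightarrow>\<^sub>E {e \<in> edges H. v \<in> e})"
  have finV: "finite (verts H)" using H by (simp add: simple_graph_def)
  have fin: "finite ?B"
    using finV S simple_graph_finite_edges[OF H] by (intro finite_SigmaI finite_PiE) auto
  have "card (homs S H) \<le> card ?B"
  proof (rule card_inj_on_le[OF _ _ fin])
    have "a \<in> \<Union>S" using S by blast
    thus "?f ` homs S H \<subseteq> ?B"
      using S by (auto simp: homs_def)
    show "inj_on ?f (homs S H)"
    proof (rule inj_onI)
      fix \<psi> \<psi>' assume h: "\<psi> \<in> homs S H" "\<psi>' \<in> homs S H" and eq: "?f \<psi> = ?f \<psi>'"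
      have a: "\<psi> a = \<psi>' a" using eq by simp
      have im: "\<psi> ` e = \<psi>' ` e" if "e \<in> S" for e
      proof -
        have "(\<lambda>e\<in>S. \<psi> ` e) e = (\<lambda>e\<in>S. \<psi>' ` e) e" using eq by simp
        thus ?thesis using that by simp
      qed
      have "\<psi> x = \<psi>' x" if x: "x \<in> \<Union>S" for x
      proof -
        obtain e where e: "e \<in> S" "x \<in> e" using x by blast
        have ed: "\<psi> ` e \<in> edges H" "\<psi>' ` e \<in> edges H" using h e by (auto simp: homs_def)
        hence c: "card (\<psi> ` e) = 2" "card (\<psi>' ` e) = 2"
          using H by (auto simp: simple_graph_def nsets_def)
        show ?thesis
        proof (cases "x = a")
          case False
          hence "e = {a, x}" using S(3)[OF e(1)] e by (auto simp: card_2_iff)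
          hence "{\<psi> a, \<psi> x} = {\<psi> a, \<psi>' x}" "card {\<psi> a, \<psi> x} = 2"
            using c im[OF e(1)] a by auto
          thus ?thesis by (cases "\<psi> a = \<psi> x") (auto simp: doubleton_eq_iff)
        qed (use a in simp)
      qed
      thus "\<psi> = \<psi>'" using h by (intro PiE_ext[of \<psi> "\<Union>S" "\<lambda>_. verts H"]) (auto simp: homs_def)
    qed
  qed
  also have "card ?B = (\<Sum>v\<in>verts H. vdegree H v ^ card S)"
    using finV S simple_graph_finite_edges[OF H]
    by (subst card_SigmaI) (auto simp: card_PiE vdegree_def intro!: finite_PiE)
  finally show ?thesis .
qed

lemma card_homs_disjoint_union:
  assumes H: "simple_graph H" and fin: "finite (\<Union>S)" "finite (\<Union>T)" and disj: "\<Union>S \<inter> \<Union>T = {}"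
  shows "card (homs (S \<union> T) H) \<le> card (homs S H) * card (homs T H)"
proof -
  let ?f = "\<lambda>\<psi>. (restrict \<psi> (\<Union>S), restrict \<psi> (\<Union>T))"
  have "card (homs (S \<union> T) H) \<le> card (homs S H \<times> homs T H)"
  proof (rule card_inj_on_le)
    show "finite (homs S H \<times> homs T H)" using fin H by (simp add: finite_homs)
    have "restrict \<psi> (\<Union>X) \<in> homs X H" if "\<psi> \<in> homs (S \<union> T) H" "X \<subseteq> S \<union> T" for \<psi> X
    proof -
      have "restrict \<psi> (\<Union>X) ` e = \<psi> ` e" if "e \<in> X" for e
        using that by (intro image_cong) auto
      moreover have "restrict \<psi> (\<Union>X) \<in> \<Union>X \<rightarrow>\<^sub>E verts H"
        using that by (auto simp: homs_def)
      ultimately show ?thesis using that by (auto simp: homs_def subset_iff)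
    qed
    thus "?f ` homs (S \<union> T) H \<subseteq> homs S H \<times> homs T H"
      by auto
    show "inj_on ?f (homs (S \<union> T) H)"
    proof (rule inj_onI)
      fix \<psi> \<psi>' assume h: "\<psi> \<in> homs (S \<union> T) H" "\<psi>' \<in> homs (S \<union> T) H" and eq: "?f \<psi> = ?f \<psi>'"
      have "\<psi> x = \<psi>' x" if "x \<in> \<Union>(S \<union> T)" for x
        using eq that by (auto dest: fun_cong[of _ _ x] split: if_splits)
      thus "\<psi> = \<psi>'" using h
        by (intro PiE_ext[of \<psi> "\<Union>(S \<union> T)" "\<lambda>_. verts H"]) (auto simp: homs_def)
    qed
  qed
  thus ?thesis by (simp add: card_cartesian_product)
qed

lemma card_insert_Union_star:
  assumes "finite T" "\<And>e. e \<in> T \<Longrightarrow> card e = 2 \<and> a \<in> e"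
  shows "card (insert a (\<Union>T)) = card T + 1"
  using assms
proof (induction T rule: finite_induct)
  case (insert e T)
  obtain x where e: "e = {a, x}" "x \<noteq> a" using insert.prems[of e] by (auto simp: card_2_iff)
  have "x \<notin> \<Union>T"
  proof
    assume "x \<in> \<Union>T"
    then obtain e' where e': "e' \<in> T" "x \<in> e'" by blast
    hence "e' = {a, x}" using insert.prems[of e'] e by (auto simp: card_2_iff)
    thus False using e e' insert.hyps by auto
  qed
  moreover have "finite f" if "f \<in> T" for f
    using insert.prems[of f] that by (intro card_ge_0_finite) auto
  ultimately have "card (insert x (insert a (\<Union>T))) = Suc (card (insert a (\<Union>T)))"
    using insert.hyps e by (intro card_insert_disjoint) auto
  also have "card (insert a (\<Union>T)) = card T + 1" using insert by auto
  also have "insert x (insert a (\<Union>T)) = insert a (\<Union>(insert e T))" using e by auto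
  finally show ?case using insert.hyps by simp
qed simp

text \<open>In a minimal edge cover every edge has a private vertex, one on no other edge.  Take an edge with private
  vertex \<open>b\<close> and other endpoint \<open>a\<close>, and all edges at \<open>a\<close>.  If there is more than one of them, then \<open>a\<close> is not
  private, so every leaf is; otherwise both
  ends of the edge are private.  Either way no other edge touches this star.\<close>

lemma minimal_cover_star_component:
  assumes ne: "S \<noteq> {}" and two: "\<And>e. e \<in> S \<Longrightarrow> card e = 2"
    and min: "\<And>e. e \<in> S \<Longrightarrow> \<Union>(S - {e}) \<noteq> \<Union>S"
  obtains T a where "T \<subseteq> S" "T \<noteq> {}" "\<forall>e\<in>T. a \<in> e" "\<Union>T \<inter> \<Union>(S - T) = {}"
proof -
  have priv: "\<exists>x\<in>e. \<forall>e'\<in>S. x \<in> e' \<longrightarrow> e' = e" if "e \<in> S" for e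
    using min[OF that] that by blast
  obtain e0 where e0: "e0 \<in> S" using ne by blast
  obtain b where b: "b \<in> e0" "\<And>e'. e' \<in> S \<Longrightarrow> b \<in> e' \<Longrightarrow> e' = e0" using priv[OF e0] by blast
  obtain a where a: "e0 = {a, b}" "a \<noteq> b" using two[OF e0] b by (auto simp: card_2_iff)
  define T where "T = {e \<in> S. a \<in> e}"
  have disj: "\<Union>T \<inter> \<Union>(S - T) = {}"
  proof (rule ccontr)
    assume "\<Union>T \<inter> \<Union>(S - T) \<noteq> {}"
    then obtain x e e' where x: "x \<in> e" "e \<in> T" "x \<in> e'" "e' \<in> S" "a \<notin> e'" "a \<in> e" "e \<in> S"
      by (auto simp: T_def)
    hence e: "e = {a, x}" using two[of e] by (auto simp: card_2_iff)
    obtain y where y: "y \<in> e" "\<And>e'. e' \<in> S \<Longrightarrow> y \<in> e' \<Longrightarrow> e' = e" using priv[of e] x by blast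
    consider "y = x" | "y = a" using y e by blast
    thus False
    proof cases
      case 1
      then show ?thesis using y x by blast
    next
      case 2
      hence "e0 = e" using y(2)[OF e0] a by blast
      hence "b = x" using a e by (auto simp: doubleton_eq_iff)
      then show ?thesis using b(2)[of e'] x a by auto
    qed
  qed
  show ?thesis
  proof (rule that)
    show "T \<noteq> {}" using e0 a by (auto simp: T_def)
  qed (use disj in \<open>auto simp: T_def\<close>)
qed

text \<open>The bound splits off one star at a time.  An edge whose removal leaves the vertex set unchanged is
  dropped, at the price of a factor \<open>lam \<le> C\<close>.  When no such edge is left, a star component is removed,
  and the hypothesis on stars pays for its \<open>t + 1\<close> vertices.\<close>

lemma homs_bound:
  fixes lam C M N :: real and H :: "'a ugraph" and S :: "'b set set"
  assumes H: "simple_graph H" and lam: "0 \<le> lam" "lam \<le> C" and C: "1 \<le> C" and M: "1 \<le> M" and N: "0 \<le> N"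
    and star: "\<And>t. 1 \<le> t \<Longrightarrow> t \<le> D \<Longrightarrow>
        lam ^ t * (\<Sum>v\<in>verts H. real (vdegree H v) ^ t) \<le> M * N ^ (t + 1)"
    and S: "finite S" "card S \<le> D" "\<And>e. e \<in> S \<Longrightarrow> card e = 2"
  shows "lam ^ card S * real (card (homs S H)) \<le> (C * M) ^ card S * N ^ card (\<Union>S)"
  using S
proof (induction "card S" arbitrary: S rule: less_induct)
  case (less S)
  have finU: "finite (\<Union>X)" if "X \<subseteq> S" for X
  proof (rule finite_Union)
    show "finite X" using less.prems that finite_subset by blast
    show "finite e" if "e \<in> X" for e
      using less.prems(3)[of e] that \<open>X \<subseteq> S\<close> by (intro card_ge_0_finite) auto
  qed
  have CM: "1 \<le> C * M" using mult_mono[of 1 C 1 M] C M by simp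
  consider "S = {}" | e where "e \<in> S" "\<Union>(S - {e}) = \<Union>S"
    | "S \<noteq> {}" "\<And>e. e \<in> S \<Longrightarrow> \<Union>(S - {e}) \<noteq> \<Union>S" by blast
  then show ?case
  proof cases
    case 1
    have "card (homs ({} :: 'b set set) H) = 1" by (simp add: homs_def)
    then show ?thesis using 1 by simp
  next
    case (2 e)
    let ?S = "S - {e}"
    have c: "card S = Suc (card ?S)"
      using card_Suc_Diff1[OF less.prems(1) 2(1)] by (rule sym)
    have "homs S H \<subseteq> homs ?S H" using 2 by (auto simp: homs_def)
    hence "card (homs S H) \<le> card (homs ?S H)"
      using finU[of ?S] H by (intro card_mono finite_homs) auto
    hence "lam ^ card S * real (card (homs S H)) \<le> lam ^ card S * real (card (homs ?S H))"
      using lam by (intro mult_left_mono) auto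
    also have "\<dots> = lam * (lam ^ card ?S * real (card (homs ?S H)))"
      unfolding c by (simp only: power_Suc mult.assoc)
    also have "\<dots> \<le> (C * M) * ((C * M) ^ card ?S * N ^ card (\<Union>?S))"
    proof (rule mult_mono)
      have "C * 1 \<le> C * M" using C M by (intro mult_left_mono) auto
      thus "lam \<le> C * M" using lam by linarith
      show "lam ^ card ?S * real (card (homs ?S H)) \<le> (C * M) ^ card ?S * N ^ card (\<Union>?S)"
      proof (rule less.hyps)
        show "card ?S < card S" "card ?S \<le> D" using c less.prems(2) by linarith+
      qed (use less.prems in auto)
    qed (use lam CM in auto)
    also have "\<dots> = (C * M) ^ card S * N ^ card (\<Union>S)"
      unfolding c 2(2) by (simp only: power_Suc mult.assoc)
    finally show ?thesis .
  next
    case 3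
    obtain T a where T: "T \<subseteq> S" "T \<noteq> {}" "\<forall>e\<in>T. a \<in> e" "\<Union>T \<inter> \<Union>(S - T) = {}"
      using minimal_cover_star_component[OF 3(1) less.prems(3) 3(2)] by metis
    have finT: "finite T" using finite_subset[OF T(1) less.prems(1)] .
    have cT: "1 \<le> card T" "card T \<le> D"
      using T(2) finT card_mono[OF less.prems(1) T(1)] less.prems(2)
      by (simp_all add: Suc_le_eq card_gt_0_iff)
    have cS: "card S = card T + card (S - T)"
      using T(1) less.prems(1) finT card_mono[of S T] by (simp add: card_Diff_subset)
    have cU: "card (\<Union>S) = (card T + 1) + card (\<Union>(S - T))"
    proof -
      have "\<Union>S = \<Union>T \<union> \<Union>(S - T)" using T(1) by blast
      hence "card (\<Union>S) = card (\<Union>T) + card (\<Union>(S - T))"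
        using card_Un_disjoint[OF finU[of T] finU[of "S - T"] T(4)] T(1) by simp
      moreover have "insert a (\<Union>T) = \<Union>T" using T by blast
      moreover have "card (insert a (\<Union>T)) = card T + 1"
        using T less.prems(3) by (intro card_insert_Union_star finT) auto
      ultimately show ?thesis by simp
    qed
    have "card (homs T H) \<le> (\<Sum>v\<in>verts H. vdegree H v ^ card T)"
      by (rule card_homs_star[OF H finT T(2), of a]) (use T(1,3) less.prems(3) in auto)
    hence "real (card (homs T H)) \<le> real (\<Sum>v\<in>verts H. vdegree H v ^ card T)"
      by (simp only: of_nat_le_iff)
    hence "lam ^ card T * real (card (homs T H))
        \<le> lam ^ card T * (\<Sum>v\<in>verts H. real (vdegree H v) ^ card T)"
      using lam by (intro mult_left_mono) auto
    also have "\<dots> \<le> M * N ^ (card T + 1)" by (rule star) (use cT in auto)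
    also have "\<dots> \<le> (C * M) ^ card T * N ^ (card T + 1)"
    proof (rule mult_right_mono)
      have "1 * M \<le> C * M" using C M by (intro mult_right_mono) auto
      hence "M \<le> (C * M) ^ 1" by simp
      also have "\<dots> \<le> (C * M) ^ card T" using cT CM by (intro power_increasing) auto
      finally show "M \<le> (C * M) ^ card T" .
    qed (use N in auto)
    finally have bT: "lam ^ card T * real (card (homs T H)) \<le> (C * M) ^ card T * N ^ (card T + 1)" .
    have bR: "lam ^ card (S - T) * real (card (homs (S - T) H))
        \<le> (C * M) ^ card (S - T) * N ^ card (\<Union>(S - T))"
    proof (rule less.hyps)
      show "card (S - T) < card S" "card (S - T) \<le> D" using cS cT less.prems(2) by linarith+
    qed (use less.prems in auto)
    have "card (homs S H) \<le> card (homs T H) * card (homs (S - T) H)"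
      using card_homs_disjoint_union[OF H finU[of T] finU[of "S - T"] T(4)] T(1)
      by (simp add: Un_absorb1)
    hence "lam ^ card S * real (card (homs S H))
        \<le> lam ^ card S * (real (card (homs T H)) * real (card (homs (S - T) H)))"
      using lam by (intro mult_left_mono) (auto simp flip: of_nat_mult)
    also have "\<dots> = (lam ^ card T * real (card (homs T H)))
        * (lam ^ card (S - T) * real (card (homs (S - T) H)))"
      unfolding cS power_add by (simp only: mult_ac)
    also have "\<dots> \<le> ((C * M) ^ card T * N ^ (card T + 1))
        * ((C * M) ^ card (S - T) * N ^ card (\<Union>(S - T)))"
      using lam N CM by (intro mult_mono bT bR) auto
    also have "\<dots> = (C * M) ^ card S * N ^ card (\<Union>S)"
      unfolding cS cU power_add by (simp only: mult_ac)
    finally show ?thesis .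
  qed
qed

lemma card_injections:
  assumes "finite A" "finite B"
  shows "card (injections A B) = (\<Prod>i<card A. card B - i)"
  using card_inj_on_subset_funcset[of A B A] assms
  by (simp add: injections_def lessThan_atLeast0)

lemma prod_lessThan_add_shift:
  fixes f :: "nat \<Rightarrow> 'c::comm_monoid_mult"
  shows "(\<Prod>i<k + m. f i) = (\<Prod>i<k. f i) * (\<Prod>i<m. f (k + i))"
  by (induction m) (simp_all add: mult_ac)

text \<open>By symmetry a uniformly random injection sends prescribed distinct points to prescribed distinct values
  with probability one over a falling factorial: what remains is an injection of the remaining points into
  the remaining values.  If \<open>\<psi>\<close> is not injective, no injection qualifies.\<close>

lemma card_injections_fixed:
  assumes fin: "finite A" "finite B" "V \<subseteq> B" and \<psi>: "\<psi> \<in> V \<rightarrow> A"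
  shows "card {\<phi> \<in> injections A B. \<forall>x\<in>V. \<phi> (\<psi> x) = x} * (\<Prod>i<card V. card B - i)
    \<le> card (injections A B)"
proof (cases "{\<phi> \<in> injections A B. \<forall>x\<in>V. \<phi> (\<psi> x) = x} = {}")
  case False
  let ?X = "{\<phi> \<in> injections A B. \<forall>x\<in>V. \<phi> (\<psi> x) = x}"
  obtain \<phi>0 where "\<phi>0 \<in> ?X" using False by blast
  hence inj: "inj_on \<psi> V" by (intro inj_onI) (metis (mono_tags, lifting) mem_Collect_eq)
  have finV: "finite V" using fin finite_subset by blast
  have cV: "card (\<psi> ` V) = card V" using inj by (simp add: card_image)
  have sub: "\<psi> ` V \<subseteq> A" using \<psi> by blast
  have kA: "card V \<le> card A" using card_mono[OF fin(1) sub] cV by simp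
  have "card ?X \<le> card (injections (A - \<psi> ` V) (B - V))"
  proof (rule card_inj_on_le)
    let ?f = "\<lambda>\<phi>. restrict \<phi> (A - \<psi> ` V)"
    show "finite (injections (A - \<psi> ` V) (B - V))" using fin by simp
    show "inj_on ?f ?X"
    proof (rule inj_onI)
      fix \<phi> \<phi>' assume h: "\<phi> \<in> ?X" "\<phi>' \<in> ?X" and eq: "?f \<phi> = ?f \<phi>'"
      have "\<phi> x = \<phi>' x" if "x \<in> A" for x
      proof (cases "x \<in> \<psi> ` V")
        case True
        then show ?thesis using h by auto
      next
        case False
        then show ?thesis using that eq by (auto dest: fun_cong[of _ _ x])
      qed
      thus "\<phi> = \<phi>'" using h by (intro PiE_ext[of \<phi> A "\<lambda>_. B"]) (auto simp: injections_def)
    qed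
    show "?f ` ?X \<subseteq> injections (A - \<psi> ` V) (B - V)"
    proof clarify
      fix \<phi> assume h: "\<phi> \<in> injections A B" "\<forall>x\<in>V. \<phi> (\<psi> x) = x"
      have "\<phi> x \<notin> V" if x: "x \<in> A" "x \<notin> \<psi> ` V" for x
      proof
        assume "\<phi> x \<in> V"
        hence "\<phi> (\<psi> (\<phi> x)) = \<phi> x" "\<psi> (\<phi> x) \<in> A" using h sub by auto
        hence "\<psi> (\<phi> x) = x" using h x by (auto simp: injections_def inj_on_def)
        thus False using x \<open>\<phi> x \<in> V\<close> by force
      qed
      thus "?f \<phi> \<in> injections (A - \<psi> ` V) (B - V)"
        using h by (auto simp: injections_def inj_on_def)
    qed
  qed
  also have "\<dots> = (\<Prod>i<card A - card V. card B - (card V + i))"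
    using fin finV sub by (simp add: card_injections card_Diff_subset cV finite_subset[OF sub])
  finally have "card ?X * (\<Prod>i<card V. card B - i)
    \<le> (\<Prod>i<card A - card V. card B - (card V + i)) * (\<Prod>i<card V. card B - i)" by simp
  also have "\<dots> = (\<Prod>i<card V + (card A - card V). card B - i)"
    by (simp add: prod_lessThan_add_shift mult.commute)
  also have "\<dots> = card (injections A B)" using fin kA by (simp add: card_injections)
  finally show ?thesis .
next
  case True
  show ?thesis unfolding True by simp
qed

lemma power_le_falling_factorial:
  assumes "k \<le> n"
  shows "n ^ k \<le> k ^ k * (\<Prod>i<k. n - i)"
proof -
  have "n ^ k = (\<Prod>i<k. n)" by simp
  also have "\<dots> \<le> (\<Prod>i<k. k * (n - i))"
  proof (rule prod_mono, clarsimp)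
    fix i assume i: "i < k"
    obtain j where j: "k = i + 1 + j" using i less_iff_Suc_add by (metis Suc_eq_plus1 add_Suc add_Suc_right)
    obtain m where m: "n = k + m" using assms le_Suc_ex by blast
    show "n \<le> k * (n - i)" unfolding m j by (simp add: algebra_simps)
  qed
  also have "\<dots> = k ^ k * (\<Prod>i<k. n - i)" by (simp add: prod.distrib)
  finally show ?thesis .
qed

text \<open>If the copy given by \<open>\<phi>\<close> contains \<open>S\<close>, then inverting \<open>\<phi>\<close> on the vertices of \<open>S\<close> gives a homomorphism from \<open>S\<close>
  to \<open>H\<close>.  The bound is a union bound over these homomorphisms.\<close>

lemma prob_random_copy_superset:
  assumes H: "simple_graph H" "card (verts H) \<le> n" and S: "S \<subseteq> pairs n"
  defines "k \<equiv> card (\<Union>S)"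
  shows "measure_pmf.prob (random_copy n H) {E. S \<subseteq> E} * real n ^ k
    \<le> real k ^ k * real (card (homs S H))"
proof -
  let ?I = "injections (verts H) {1..n}"
  let ?X = "{\<phi> \<in> ?I. S \<subseteq> (\<lambda>e. \<phi> ` e) ` edges H}"
  let ?Y = "\<lambda>\<psi>. {\<phi> \<in> ?I. \<forall>x\<in>\<Union>S. \<phi> (\<psi> x) = x}"
  let ?q = "\<Prod>i<k. n - i"
  have finH: "finite (verts H)" using H by (simp add: simple_graph_def)
  have finI: "finite ?I" using finH by simp
  have neI: "?I \<noteq> {}" using injections_nonempty[of "verts H" "{1..n}"] finH H by simp
  have US: "\<Union>S \<subseteq> {1..n}" using S by (auto simp: pairs_def nsets_def)
  hence finU: "finite (\<Union>S)" and kn: "k \<le> n"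
    using finite_subset card_mono[OF _ US] by (auto simp: k_def)
  have finh: "finite (homs S H)" using finite_homs finU H by blast
  have "?X \<subseteq> (\<Union>\<psi>\<in>homs S H. ?Y \<psi>)"
  proof clarify
    fix \<phi> assume \<phi>: "\<phi> \<in> ?I" "S \<subseteq> (\<lambda>e. \<phi> ` e) ` edges H"
    have inj: "inj_on \<phi> (verts H)" using \<phi> by (auto simp: injections_def)
    define \<psi> where "\<psi> = (\<lambda>x\<in>\<Union>S. the_inv_into (verts H) \<phi> x)"
    have sub: "e \<subseteq> verts H" if "e \<in> edges H" for e
      using that H by (auto simp: simple_graph_def nsets_def)
    have inv: "\<psi> ` (\<phi> ` e) = e" if e: "e \<in> edges H" "\<phi> ` e \<in> S" for e
    proof -
      have "\<psi> (\<phi> y) = y" if "y \<in> e" for y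
        using that e sub[OF e(1)] inj by (auto simp: \<psi>_def the_inv_into_f_f)
      thus ?thesis by (force simp: image_image)
    qed
    have pre: "\<exists>y\<in>verts H. x = \<phi> y \<and> \<psi> x = y" if x: "x \<in> \<Union>S" for x
    proof -
      obtain e where e: "e \<in> S" "x \<in> e" using x by blast
      then obtain e' where e': "e' \<in> edges H" "e = \<phi> ` e'" using \<phi> by blast
      then obtain y where y: "y \<in> e'" "x = \<phi> y" using e by blast
      thus ?thesis using sub[OF e'(1)] inj x by (auto simp: \<psi>_def the_inv_into_f_f)
    qed
    have "\<psi> \<in> homs S H"
    proof -
      have "\<psi> \<in> \<Union>S \<rightarrow>\<^sub>E verts H" using pre by (auto simp: \<psi>_def)
      moreover have "\<psi> ` e \<in> edges H" if "e \<in> S" for e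
        using that \<phi> inv by (metis (no_types, lifting) imageE subsetD)
      ultimately show ?thesis by (auto simp: homs_def)
    qed
    moreover have "\<forall>x\<in>\<Union>S. \<phi> (\<psi> x) = x" using pre by metis
    ultimately show "\<phi> \<in> (\<Union>\<psi>\<in>homs S H. ?Y \<psi>)" using \<phi> by blast
  qed
  hence "card ?X \<le> card (\<Union>\<psi>\<in>homs S H. ?Y \<psi>)"
    using finh finI by (intro card_mono) auto
  also have "\<dots> \<le> (\<Sum>\<psi>\<in>homs S H. card (?Y \<psi>))" by (rule card_UN_le[OF finh])
  finally have "card ?X * ?q \<le> (\<Sum>\<psi>\<in>homs S H. card (?Y \<psi>) * ?q)"
    by (simp add: sum_distrib_right[symmetric])
  also have "\<dots> \<le> (\<Sum>\<psi>\<in>homs S H. card ?I)"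
  proof (rule sum_mono)
    fix \<psi> assume "\<psi> \<in> homs S H"
    hence "\<psi> \<in> \<Union>S \<rightarrow> verts H" by (auto simp: homs_def)
    from card_injections_fixed[OF finH _ US this]
    show "card (?Y \<psi>) * ?q \<le> card ?I" by (simp add: k_def)
  qed
  finally have *: "card ?X * ?q \<le> card (homs S H) * card ?I" by simp
  have "card ?X * n ^ k \<le> card ?X * (k ^ k * ?q)"
    using power_le_falling_factorial[OF kn] by (rule mult_left_mono) simp
  also have "\<dots> = k ^ k * (card ?X * ?q)" by simp
  also have "\<dots> \<le> k ^ k * (card (homs S H) * card ?I)" using * by (rule mult_left_mono) simp
  finally have "card ?X * n ^ k \<le> k ^ k * card (homs S H) * card ?I" by (simp add: mult_ac)
  hence r: "real (card ?X) * real n ^ k \<le> real k ^ k * real (card (homs S H)) * real (card ?I)"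
    by (metis (mono_tags, lifting) of_nat_le_iff of_nat_mult of_nat_power)
  have "measure_pmf.prob (random_copy n H) {E. S \<subseteq> E} = real (card ?X) / real (card ?I)"
    using neI finI by (simp add: random_copy_def measure_pmf_of_set vimage_def Int_def)
  moreover have "real (card ?I) > 0" using neI finI by (simp add: card_gt_0_iff)
  ultimately show ?thesis using r by (simp add: pos_divide_le_eq)
qed

section \<open>Low-degree polynomials and their advantage\<close>

definition small_edge_sets :: "nat \<Rightarrow> nat \<Rightarrow> nat set set set" where
  "small_edge_sets n D = {S. S \<subseteq> pairs n \<and> card S \<le> D}"

text \<open>Both bases that matter are of this form: \<open>h e G\<close> is the edge indicator for polynomials and the normalised
  edge variable for characters.  Each is an affine function of the other.\<close>

definition multilinear_span :: "(nat set \<Rightarrow> edge_vec \<Rightarrow> real) \<Rightarrow> nat \<Rightarrow> nat \<Rightarrow> (edge_vec \<Rightarrow> real) set" where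
  "multilinear_span h n D = {g. \<exists>c. \<forall>G. g G = (\<Sum>S\<in>small_edge_sets n D. c S * (\<Prod>e\<in>S. h e G))}"

lemma finite_small_edge_sets [simp]: "finite (small_edge_sets n D)"
  unfolding small_edge_sets_def by (rule finite_subset[of _ "Pow (pairs n)"]) auto

lemma finite_of_small_edge_sets: "S \<in> small_edge_sets n D \<Longrightarrow> finite S"
  unfolding small_edge_sets_def using finite_pairs finite_subset by blast

lemma multilinear_span_scale: "g \<in> multilinear_span h n D \<Longrightarrow> (\<lambda>G. a * g G) \<in> multilinear_span h n D"
proof -
  assume "g \<in> multilinear_span h n D"
  then obtain c where "\<forall>G. g G = (\<Sum>S\<in>small_edge_sets n D. c S * (\<Prod>e\<in>S. h e G))"
    by (auto simp: multilinear_span_def)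
  thus ?thesis unfolding multilinear_span_def
    by (auto intro!: exI[of _ "\<lambda>S. a * c S"] simp: sum_distrib_left mult.assoc)
qed

lemma multilinear_span_sum:
  assumes "finite A" "\<And>a. a \<in> A \<Longrightarrow> f a \<in> multilinear_span h n D"
  shows "(\<lambda>G. \<Sum>a\<in>A. f a G) \<in> multilinear_span h n D"
proof -
  have "\<forall>a\<in>A. \<exists>c. \<forall>G. f a G = (\<Sum>S\<in>small_edge_sets n D. c S * (\<Prod>e\<in>S. h e G))"
    using assms(2) by (auto simp: multilinear_span_def)
  from bchoice[OF this] obtain c where
    c: "\<forall>a\<in>A. \<forall>G. f a G = (\<Sum>S\<in>small_edge_sets n D. c a S * (\<Prod>e\<in>S. h e G))"
    by (elim exE)
  have "(\<Sum>a\<in>A. f a G) = (\<Sum>S\<in>small_edge_sets n D. (\<Sum>a\<in>A. c a S) * (\<Prod>e\<in>S. h e G))" for G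
  proof -
    have "(\<Sum>a\<in>A. f a G) = (\<Sum>a\<in>A. \<Sum>S\<in>small_edge_sets n D. c a S * (\<Prod>e\<in>S. h e G))"
      using c by (intro sum.cong) auto
    also have "\<dots> = (\<Sum>S\<in>small_edge_sets n D. \<Sum>a\<in>A. c a S * (\<Prod>e\<in>S. h e G))" by (rule sum.swap)
    finally show ?thesis by (simp only: sum_distrib_right)
  qed
  thus ?thesis unfolding multilinear_span_def by (intro CollectI exI allI)
qed

lemma multilinear_span_monomial:
  assumes "X \<in> small_edge_sets n D"
  shows "(\<lambda>G. \<Prod>e\<in>X. h e G) \<in> multilinear_span h n D"
proof -
  have "(\<Prod>e\<in>X. h e G) = (\<Sum>S\<in>small_edge_sets n D. of_bool (S = X) * (\<Prod>e\<in>S. h e G))" for G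
    using assms by (subst sum.remove[of _ X]) auto
  thus ?thesis unfolding multilinear_span_def by (intro CollectI exI allI)
qed

text \<open>Expanding the product over subsets of \<open>K\<close> does not raise the degree; this is the change of basis between
  indicators and characters.\<close>

lemma multilinear_span_prod_affine:
  assumes K: "K \<in> small_edge_sets n D"
  shows "(\<lambda>G. \<Prod>e\<in>K. a + b * h e G) \<in> multilinear_span h n D"
proof -
  have finK: "finite K" using K by (rule finite_of_small_edge_sets)
  have "(\<Prod>e\<in>K. a + b * h e G) =
      (\<Sum>X\<in>Pow K. (a ^ card (K - X) * b ^ card X) * (\<Prod>e\<in>X. h e G))" for G
  proof -
    have "(\<Prod>e\<in>K. a + b * h e G) = (\<Prod>e\<in>K. b * h e G + a)" by (simp add: add.commute)
    also have "\<dots> = (\<Sum>X\<in>Pow K. (\<Prod>e\<in>X. b * h e G) * (\<Prod>e\<in>K - X. a))" by (rule prod_add[OF finK])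
    finally show ?thesis by (simp add: prod.distrib mult_ac)
  qed
  moreover have "(\<lambda>G. \<Sum>X\<in>Pow K. (a ^ card (K - X) * b ^ card X) * (\<Prod>e\<in>X. h e G)) \<in> multilinear_span h n D"
  proof (intro multilinear_span_sum multilinear_span_scale multilinear_span_monomial)
    fix X assume "X \<in> Pow K"
    thus "X \<in> small_edge_sets n D" using K finK card_mono[of K X] by (auto simp: small_edge_sets_def)
  qed (use finK in simp)
  ultimately show ?thesis by simp
qed

definition edge_character :: "real \<Rightarrow> nat set \<Rightarrow> edge_vec \<Rightarrow> real" where
  "edge_character p e G = (of_bool (G e) - p) / sqrt (p * (1 - p))"

lemma fchar_eq_prod: "fchar p S G = (\<Prod>e\<in>S. edge_character p e G)"
  by (simp add: fchar_def edge_character_def)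

text \<open>Edge indicators are idempotent, so each monomial acts as the product of its variables, whatever the
  exponents.\<close>

lemma poly_fun_in_character_span:
  assumes p: "0 < p" "p < 1" and f: "mpoly_vars f \<subseteq> pairs n" "mpoly_degree f \<le> D"
  shows "poly_fun f \<in> multilinear_span (edge_character p) n D"
proof -
  have s: "sqrt (p * (1 - p)) > 0" using p by simp
  have eq: "poly_fun f = (\<lambda>G. \<Sum>m\<in>Poly_Mapping.keys f. Poly_Mapping.lookup f m *
      (\<Prod>e\<in>Poly_Mapping.keys m. p + sqrt (p * (1 - p)) * edge_character p e G))"
  proof
    fix G
    have "(of_bool (G v) :: real) ^ Poly_Mapping.lookup m v = p + sqrt (p * (1 - p)) * edge_character p v G"
      if "v \<in> Poly_Mapping.keys m" for m v
      using that p by (auto simp: edge_character_def in_keys_iff)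
    thus "poly_fun f G = (\<Sum>m\<in>Poly_Mapping.keys f. Poly_Mapping.lookup f m *
      (\<Prod>e\<in>Poly_Mapping.keys m. p + sqrt (p * (1 - p)) * edge_character p e G))"
      unfolding poly_fun_def mpoly_eval_def
      by (intro sum.cong refl arg_cong2[of _ _ _ _ "(*)"] prod.cong) auto
  qed
  have "Poly_Mapping.keys m \<in> small_edge_sets n D" if m: "m \<in> Poly_Mapping.keys f" for m
  proof -
    have "card (Poly_Mapping.keys m) = (\<Sum>v\<in>Poly_Mapping.keys m. 1)" by simp
    also have "\<dots> \<le> (\<Sum>v\<in>Poly_Mapping.keys m. Poly_Mapping.lookup m v)"
      by (intro sum_mono) (simp add: in_keys_iff Suc_le_eq)
    also have "\<dots> \<le> mpoly_degree f"
      unfolding mpoly_degree_def using m by (intro Max_ge) auto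
    finally show ?thesis using f m by (auto simp: small_edge_sets_def mpoly_vars_def)
  qed
  thus ?thesis unfolding eq by (intro multilinear_span_sum multilinear_span_scale multilinear_span_prod_affine) auto
qed

text \<open>A set of edges is turned into the square-free monomial of its elements.\<close>

lemma polynomial_of_multilinear:
  assumes g: "g \<in> multilinear_span (\<lambda>e G. of_bool (G e)) n D"
  obtains f where "mpoly_vars f \<subseteq> pairs n" "mpoly_degree f \<le> D" "poly_fun f = g"
proof -
  from g have "\<exists>c. \<forall>G. g G = (\<Sum>S\<in>small_edge_sets n D. c S * (\<Prod>e\<in>S. of_bool (G e)))"
    by (simp add: multilinear_span_def)
  then obtain c where c: "\<forall>G. g G = (\<Sum>S\<in>small_edge_sets n D. c S * (\<Prod>e\<in>S. of_bool (G e)))"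
    by (elim exE)
  define mon :: "nat set set \<Rightarrow> nat set \<Rightarrow>\<^sub>0 nat" where
    "mon = (\<lambda>S. \<Sum>e\<in>S. Poly_Mapping.single e 1)"
  have lk: "Poly_Mapping.lookup (mon S) v = of_bool (v \<in> S)" if "finite S" for S v
    using that by (simp add: mon_def lookup_sum lookup_single when_def)
  have ks: "Poly_Mapping.keys (mon S) = S" if "finite S" for S
    using lk[OF that] by (auto simp: in_keys_iff)
  have inj: "inj_on mon (small_edge_sets n D)"
  proof (rule inj_onI)
    fix S T assume "S \<in> small_edge_sets n D" "T \<in> small_edge_sets n D" and eq: "mon S = mon T"
    hence "finite S" "finite T" by (auto dest: finite_of_small_edge_sets)
    thus "S = T" using ks eq by metis
  qed
  define f where "f = (\<Sum>S\<in>small_edge_sets n D. Poly_Mapping.single (mon S) (c S))"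
  have lf: "Poly_Mapping.lookup f (mon S) = c S" if S: "S \<in> small_edge_sets n D" for S
  proof -
    have "Poly_Mapping.lookup f (mon S) = (\<Sum>S'\<in>small_edge_sets n D. if S' = S then c S' else 0)"
      unfolding f_def lookup_sum lookup_single
      by (intro sum.cong refl) (simp add: when_def inj_on_eq_iff[OF inj _ S])
    thus ?thesis using S by simp
  qed
  have kf: "Poly_Mapping.keys f \<subseteq> mon ` small_edge_sets n D"
  proof
    fix m assume "m \<in> Poly_Mapping.keys f"
    hence "(\<Sum>S\<in>small_edge_sets n D. (c S when mon S = m)) \<noteq> 0"
      by (simp add: f_def in_keys_iff lookup_sum lookup_single)
    then obtain S where "S \<in> small_edge_sets n D" "(c S when mon S = m) \<noteq> 0"
      by (rule sum.not_neutral_contains_not_neutral)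
    thus "m \<in> mon ` small_edge_sets n D" by (auto simp: when_def split: if_splits)
  qed
  have "mpoly_vars f \<subseteq> pairs n"
    unfolding mpoly_vars_def
  proof (rule UN_least)
    fix m assume "m \<in> Poly_Mapping.keys f"
    then obtain S where S: "S \<in> small_edge_sets n D" "m = mon S" using kf by blast
    from ks[OF finite_of_small_edge_sets[OF S(1)]] S show "Poly_Mapping.keys m \<subseteq> pairs n"
      by (simp add: small_edge_sets_def)
  qed
  moreover have "mpoly_degree f \<le> D"
  proof -
    have "(\<Sum>v\<in>Poly_Mapping.keys m. Poly_Mapping.lookup m v) \<le> D" if m: "m \<in> Poly_Mapping.keys f" for m
    proof -
      obtain S where S: "S \<in> small_edge_sets n D" "m = mon S" using kf m by blast
      thus ?thesis using finite_of_small_edge_sets[OF S(1)] by (simp add: ks lk small_edge_sets_def)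
    qed
    thus ?thesis unfolding mpoly_degree_def by (subst Max_le_iff) auto
  qed
  moreover have "poly_fun f G = g G" for G
  proof -
    let ?t = "\<lambda>m. Poly_Mapping.lookup f m *
        (\<Prod>v\<in>Poly_Mapping.keys m. (of_bool (G v) :: real) ^ Poly_Mapping.lookup m v)"
    have "poly_fun f G = (\<Sum>m\<in>mon ` small_edge_sets n D. ?t m)"
      unfolding poly_fun_def mpoly_eval_def
      by (intro sum.mono_neutral_left) (use kf in \<open>auto simp: in_keys_iff\<close>)
    also have "\<dots> = (\<Sum>S\<in>small_edge_sets n D. ?t (mon S))"
      by (simp add: sum.reindex[OF inj])
    also have "\<dots> = g G"
      unfolding c[rule_format]
    proof (intro sum.cong refl arg_cong2[of _ _ _ _ "(*)"] lf)
      fix S assume "S \<in> small_edge_sets n D"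
      hence "finite S" by (rule finite_of_small_edge_sets)
      thus "(\<Prod>v\<in>Poly_Mapping.keys (mon S). (of_bool (G v) :: real) ^ Poly_Mapping.lookup (mon S) v)
        = (\<Prod>e\<in>S. of_bool (G e))"
        by (simp add: ks lk)
    qed
    finally show ?thesis .
  qed
  hence "poly_fun f = g" by (rule ext)
  ultimately show ?thesis by (rule that)
qed

lemma expectation_sum_finite:
  fixes f :: "'i \<Rightarrow> 'b \<Rightarrow> real"
  assumes "finite (set_pmf M)"
  shows "measure_pmf.expectation M (\<lambda>x. \<Sum>i\<in>A. f i x) = (\<Sum>i\<in>A. measure_pmf.expectation M (f i))"
  by (intro Bochner_Integration.integral_sum integrable_measure_pmf_finite assms)

text \<open>Expand \<open>g\<close> in characters.  The nonempty ones are centred and orthonormal under the null model, so the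
  variance is the sum of the squared coefficients, while the difference of means is the inner product of the
  coefficients with the planted means of the characters.\<close>

lemma low_degree_advantage:
  assumes p: "0 < p" "p < 1" and H: "simple_graph H" "card (verts H) \<le> n"
    and g: "g \<in> multilinear_span (edge_character p) n D"
  shows "(measure_pmf.expectation (planted n p H) g - measure_pmf.expectation (erdos_renyi n p) g)\<^sup>2
    \<le> measure_pmf.variance (erdos_renyi n p) g *
       (\<Sum>S\<in>small_edge_sets n D - {{}}. (measure_pmf.expectation (planted n p H) (fchar p S))\<^sup>2)"
proof -
  let ?L = "small_edge_sets n D" and ?EP = "measure_pmf.expectation (planted n p H)"
    and ?EQ = "measure_pmf.expectation (erdos_renyi n p)"
  obtain c where c: "g = (\<lambda>G. \<Sum>S\<in>?L. c S * fchar p S G)"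
    using g by (auto simp: multilinear_span_def fchar_eq_prod)
  have sub: "S \<subseteq> pairs n" if "S \<in> ?L" for S using that by (simp add: small_edge_sets_def)
  have EQ: "?EQ (fchar p S) = of_bool (S = {})" if "S \<in> ?L" for S
    using expectation_fchar_overlay[OF p sub[OF that], of "{}"] by simp
  have EQ2: "?EQ (\<lambda>G. fchar p S G * fchar p T G) = of_bool (S = T)" if "S \<in> ?L" "T \<in> ?L" for S T
    using expectation_fchar_overlay_mult[OF p sub[OF that(1)] sub[OF that(2)], of "{}"] by auto
  have e: "{} \<in> ?L" by (simp add: small_edge_sets_def)
  have f0: "fchar p {} = (\<lambda>_. 1)" by (simp add: fchar_def fun_eq_iff)
  have EQg: "?EQ g = c {}"
  proof -
    have "?EQ g = (\<Sum>S\<in>?L. c S * ?EQ (fchar p S))"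
      unfolding c by (subst expectation_sum_finite) auto
    also have "\<dots> = (\<Sum>S\<in>?L. if S = {} then c S else 0)" by (intro sum.cong) (auto simp: EQ)
    finally show ?thesis using e by simp
  qed
  have "?EP g = (\<Sum>S\<in>?L. c S * ?EP (fchar p S))"
    unfolding c using H by (subst expectation_sum_finite) auto
  also have "\<dots> = c {} + (\<Sum>S\<in>?L - {{}}. c S * ?EP (fchar p S))"
    using e by (subst sum.remove[of _ "{}"]) (auto simp: f0)
  finally have diff: "?EP g - ?EQ g = (\<Sum>S\<in>?L - {{}}. c S * ?EP (fchar p S))" by (simp add: EQg)
  have ctr: "(g G - ?EQ g)\<^sup>2 =
      (\<Sum>S\<in>?L - {{}}. \<Sum>T\<in>?L - {{}}. c S * c T * (fchar p S G * fchar p T G))" for G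
  proof -
    have "g G - ?EQ g = (\<Sum>S\<in>?L - {{}}. c S * fchar p S G)"
      unfolding EQg unfolding c using e by (subst sum.remove[of _ "{}"]) (auto simp: f0)
    thus ?thesis by (simp add: power2_eq_square sum_product mult_ac)
  qed
  have "measure_pmf.variance (erdos_renyi n p) g =
      (\<Sum>S\<in>?L - {{}}. \<Sum>T\<in>?L - {{}}. c S * c T * ?EQ (\<lambda>G. fchar p S G * fchar p T G))"
    unfolding ctr by (simp add: expectation_sum_finite)
  also have "\<dots> = (\<Sum>S\<in>?L - {{}}. \<Sum>T\<in>?L - {{}}. if T = S then c S * c T else 0)"
    by (intro sum.cong refl) (auto simp: EQ2)
  also have "\<dots> = (\<Sum>S\<in>?L - {{}}. (c S)\<^sup>2)"
    by (intro sum.cong refl) (simp add: power2_eq_square)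
  finally have var: "measure_pmf.variance (erdos_renyi n p) g = (\<Sum>S\<in>?L - {{}}. (c S)\<^sup>2)" .
  show ?thesis unfolding diff var by (rule Cauchy_Schwarz_ineq_sum)
qed

text \<open>The form in which the ratio is used throughout, with natural exponents only.\<close>

lemma star_ratio_eq:
  assumes p: "0 < p" "p < 1" and n: "0 < n"
  shows "edge_signal p ^ t * (\<Sum>v\<in>verts H. real (vdegree H v) ^ t) = star_ratio n p H t * sqrt (real n) ^ (t + 1)"
proof -
  have "real n powr ((1 + real t) / 2) = (real n powr (1/2)) powr real (t + 1)"
    by (simp add: powr_powr add.commute)
  also have "\<dots> = sqrt (real n) ^ (t + 1)" unfolding powr_half_sqrt[OF of_nat_0_le_iff] using n by (subst powr_realpow) auto
  finally have 1: "real n powr ((1 + real t) / 2) = sqrt (real n) ^ (t + 1)" .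
  have "(p / (1 - p)) powr (real t / 2) = ((p / (1 - p)) powr (1/2)) powr real t"
    by (simp add: powr_powr)
  also have "\<dots> = sqrt (p / (1 - p)) ^ t" using p by (simp add: powr_half_sqrt powr_realpow)
  finally have 2: "(p / (1 - p)) powr (real t / 2) = sqrt (p / (1 - p)) ^ t" .
  have "edge_signal p * sqrt (p / (1 - p)) = 1"
    using p by (simp add: edge_signal_def real_sqrt_mult[symmetric])
  hence 3: "edge_signal p ^ t * sqrt (p / (1 - p)) ^ t = 1" by (metis power_mult_distrib power_one)
  have "sqrt (p / (1 - p)) ^ t \<noteq> 0" "sqrt (real n) ^ (t + 1) \<noteq> 0" using p n by auto
  moreover from this 3 have "edge_signal p ^ t = 1 / sqrt (p / (1 - p)) ^ t" by (simp add: eq_divide_eq)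
  ultimately show ?thesis unfolding star_ratio_def 1 2 by (simp del: power_Suc)
qed

text \<open>There are at most \<open>n ^ k\<close> sets of \<open>k\<close> vertices, so every size contributes at most \<open>1\<close>.\<close>

lemma sum_inverse_power_card_le:
  assumes n: "0 < n"
  shows "(\<Sum>V | V \<subseteq> {1..n} \<and> card V \<le> m. 1 / real n ^ card V) \<le> real (m + 1)"
proof -
  let ?Vs = "{V. V \<subseteq> {1..n} \<and> card V \<le> m}"
  have fin: "finite ?Vs" by (rule finite_subset[of _ "Pow {1..n}"]) auto
  have "(\<Sum>V\<in>?Vs. 1 / real n ^ card V) = (\<Sum>k\<le>m. \<Sum>V | V \<in> ?Vs \<and> card V = k. 1 / real n ^ card V)"
    by (rule sum.group[symmetric]) (use fin in auto)
  also have "\<dots> \<le> (\<Sum>k\<le>m. 1)"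
  proof (rule sum_mono)
    fix k assume "k \<in> {..m}"
    hence "{V. V \<in> ?Vs \<and> card V = k} = {V. V \<subseteq> {1..n} \<and> card V = k}" by auto
    hence "(\<Sum>V | V \<in> ?Vs \<and> card V = k. 1 / real n ^ card V) = real (n choose k) / real n ^ k"
      using n_subsets[of "{1..n}" k] by simp
    also have "real (n choose k) \<le> real n ^ k"
    proof (cases "k \<le> n")
      case True
      show ?thesis using binomial_le_pow[OF True] by (metis of_nat_le_iff of_nat_power)
    qed (simp add: binomial_eq_0)
    hence "real (n choose k) / real n ^ k \<le> 1" using n by simp
    finally show "(\<Sum>V | V \<in> ?Vs \<and> card V = k. 1 / real n ^ card V) \<le> 1" .
  qed
  finally show ?thesis by simp
qed

definition advantage_const :: "real \<Rightarrow> nat \<Rightarrow> real" where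
  "advantage_const C D = real (2 ^ 2 ^ (2 * D)) * real (2 * D + 1) * (real (2 * D) ^ (2 * D) * C ^ D)\<^sup>2"

text \<open>Let \<open>k\<close> be the number of vertices of \<open>S\<close>.  The homomorphism bound with \<open>N = sqrt n\<close> leaves
  \<open>sqrt n ^ k / n ^ k\<close> in the planted mean of the character, that is \<open>1 / n ^ k\<close> after squaring.  At most
  \<open>2 ^ 2 ^ k\<close> edge sets span a given set of \<open>k \<le> 2 * D\<close> vertices.\<close>

lemma advantage_bound:
  assumes p: "0 < p" "p < 1" and H: "simple_graph H" "card (verts H) \<le> n" and n: "0 < n"
    and C: "edge_signal p \<le> C" "1 \<le> C" and M: "1 \<le> M"
    and R: "\<And>t. 1 \<le> t \<Longrightarrow> t \<le> D \<Longrightarrow> star_ratio n p H t \<le> M"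
  shows "(\<Sum>S\<in>small_edge_sets n D - {{}}. (measure_pmf.expectation (planted n p H) (fchar p S))\<^sup>2)
    \<le> advantage_const C D * (M ^ D)\<^sup>2"
proof -
  let ?L = "small_edge_sets n D - {{}}"
  let ?Vs = "{V. V \<subseteq> {1..n} \<and> card V \<le> 2 * D}"
  \<comment> \<open>bounds \<open>sqrt n ^ k\<close> times the planted mean of each character\<close>
  define B where "B = real (2 * D) ^ (2 * D) * (C * M) ^ D"
  have CM: "1 \<le> C * M" using mult_mono[of 1 C 1 M] C M by simp
  have fin: "finite ?Vs" by (rule finite_subset[of _ "Pow {1..n}"]) auto
  have two: "card e = 2" if "e \<in> S" "S \<in> ?L" for e S
    using that by (auto simp: small_edge_sets_def pairs_def nsets_def)
  have V: "\<Union>S \<in> ?Vs" if S: "S \<in> ?L" for S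
  proof -
    have "card (\<Union>S) \<le> (\<Sum>e\<in>S. card e)" by (rule card_Union_le_sum_card)
    also have "\<dots> = 2 * card S" using two[OF _ S] by simp
    finally show ?thesis using S by (auto simp: small_edge_sets_def pairs_def nsets_def)
  qed
  have bound: "(measure_pmf.expectation (planted n p H) (fchar p S))\<^sup>2 \<le> B\<^sup>2 * (1 / real n ^ card (\<Union>S))"
    if S: "S \<in> ?L" for S
  proof -
    define k where "k = card (\<Union>S)"
    let ?P = "measure_pmf.prob (random_copy n H) {E. S \<subseteq> E}"
    have sub: "S \<subseteq> pairs n" and cS: "card S \<le> D" using S by (auto simp: small_edge_sets_def)
    have finS: "finite S" using sub finite_subset finite_pairs by blast
    have s0: "0 < edge_signal p" using p by (rule edge_signal_pos)
    have "\<Union>S \<noteq> {}" using S two by fastforce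
    moreover have "finite (\<Union>S)" using V[OF S] finite_subset by blast
    ultimately have k: "1 \<le> k" "k \<le> 2 * D" using V[OF S]
      by (auto simp: k_def Suc_le_eq card_gt_0_iff)
    have hb: "edge_signal p ^ card S * real (card (homs S H)) \<le> (C * M) ^ card S * sqrt (real n) ^ k"
      unfolding k_def
    proof (rule homs_bound[where D = D])
      fix t assume t: "1 \<le> t" "t \<le> D"
      show "edge_signal p ^ t * (\<Sum>v\<in>verts H. real (vdegree H v) ^ t) \<le> M * sqrt (real n) ^ (t + 1)"
        unfolding star_ratio_eq[OF p n] by (intro mult_right_mono R t) auto
    qed (use s0 C M H finS cS two S in auto)
    have "edge_signal p ^ card S * ?P * real n ^ k \<le> edge_signal p ^ card S * (real k ^ k * real (card (homs S H)))"
      unfolding mult.assoc using prob_random_copy_superset[OF H sub] s0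
      by (intro mult_left_mono) (auto simp: k_def)
    also have "\<dots> = real k ^ k * (edge_signal p ^ card S * real (card (homs S H)))" by simp
    also have "\<dots> \<le> real (2 * D) ^ (2 * D) * ((C * M) ^ D * sqrt (real n) ^ k)"
    proof (rule mult_mono)
      have "real k ^ k \<le> real (2 * D) ^ k" using k by (intro power_mono) auto
      also have "\<dots> \<le> real (2 * D) ^ (2 * D)" using k by (intro power_increasing) auto
      finally show "real k ^ k \<le> real (2 * D) ^ (2 * D)" .
      have "(C * M) ^ card S * sqrt (real n) ^ k \<le> (C * M) ^ D * sqrt (real n) ^ k"
        by (intro mult_right_mono power_increasing cS CM) simp
      with hb show "edge_signal p ^ card S * real (card (homs S H)) \<le> (C * M) ^ D * sqrt (real n) ^ k"
        by (rule order.trans)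
    qed (use s0 in auto)
    finally have le: "(edge_signal p ^ card S * ?P) * real n ^ k \<le> B * sqrt (real n) ^ k" by (simp add: B_def)
    have nk: "real n ^ k = sqrt (real n) ^ k * sqrt (real n) ^ k"
      by (simp flip: power_mult_distrib)
    from this le have "(edge_signal p ^ card S * ?P) * sqrt (real n) ^ k * sqrt (real n) ^ k \<le> B * sqrt (real n) ^ k"
      by (simp only: mult.assoc)
    hence le': "(edge_signal p ^ card S * ?P) * sqrt (real n) ^ k \<le> B"
      by (rule mult_right_le_imp_le) (use n in simp)
    have "((edge_signal p ^ card S * ?P) * sqrt (real n) ^ k)\<^sup>2 \<le> B\<^sup>2"
      using le' s0 by (intro power_mono) auto
    moreover have "(sqrt (real n) ^ k)\<^sup>2 = real n ^ k" by (simp only: nk power2_eq_square)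
    ultimately have "(edge_signal p ^ card S * ?P)\<^sup>2 * real n ^ k \<le> B\<^sup>2"
      by (simp only: power_mult_distrib[of _ "sqrt (real n) ^ k"])
    moreover have "0 < real n ^ k" using n by simp
    ultimately have "(edge_signal p ^ card S * ?P)\<^sup>2 \<le> B\<^sup>2 / real n ^ k"
      by (simp only: pos_le_divide_eq)
    thus ?thesis unfolding expectation_fchar_planted[OF p H sub] by (simp add: k_def)
  qed
  have cnt: "card {S \<in> ?L. \<Union>S = V} \<le> 2 ^ 2 ^ (2 * D)" if V: "V \<in> ?Vs" for V
  proof -
    have fV: "finite V" using V finite_subset by blast
    have "card {S \<in> ?L. \<Union>S = V} \<le> card (Pow (Pow V))"
      using fV by (intro card_mono) auto
    also have "\<dots> = 2 ^ 2 ^ card V" using fV by (simp add: card_Pow)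
    also have "\<dots> \<le> 2 ^ 2 ^ (2 * D)" using V by (intro power_increasing) auto
    finally show ?thesis .
  qed
  have "(\<Sum>S\<in>?L. 1 / real n ^ card (\<Union>S)) =
      (\<Sum>V\<in>?Vs. \<Sum>S | S \<in> ?L \<and> \<Union>S = V. 1 / real n ^ card (\<Union>S))"
    by (rule sum.group[symmetric]) (use fin V in auto)
  also have "\<dots> = (\<Sum>V\<in>?Vs. real (card {S \<in> ?L. \<Union>S = V}) * (1 / real n ^ card V))"
    by (intro sum.cong) auto
  also have "\<dots> \<le> (\<Sum>V\<in>?Vs. real (2 ^ 2 ^ (2 * D)) * (1 / real n ^ card V))"
  proof (intro sum_mono mult_right_mono)
    fix V assume "V \<in> ?Vs"
    from cnt[OF this] show "real (card {S \<in> ?L. \<Union>S = V}) \<le> real (2 ^ 2 ^ (2 * D))"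
      by (rule of_nat_mono)
  qed simp
  also have "\<dots> = real (2 ^ 2 ^ (2 * D)) * (\<Sum>V\<in>?Vs. 1 / real n ^ card V)"
    by (simp only: sum_distrib_left)
  also have "\<dots> \<le> real (2 ^ 2 ^ (2 * D)) * real (2 * D + 1)"
    by (intro mult_left_mono sum_inverse_power_card_le n of_nat_0_le_iff)
  finally have shapes: "(\<Sum>S\<in>?L. 1 / real n ^ card (\<Union>S)) \<le> real (2 ^ 2 ^ (2 * D)) * real (2 * D + 1)" .
  have "(\<Sum>S\<in>?L. (measure_pmf.expectation (planted n p H) (fchar p S))\<^sup>2)
      \<le> (\<Sum>S\<in>?L. B\<^sup>2 * (1 / real n ^ card (\<Union>S)))" by (intro sum_mono bound)
  also have "\<dots> = B\<^sup>2 * (\<Sum>S\<in>?L. 1 / real n ^ card (\<Union>S))" by (simp only: sum_distrib_left)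
  also have "\<dots> \<le> B\<^sup>2 * (real (2 ^ 2 ^ (2 * D)) * real (2 * D + 1))"
    by (intro mult_left_mono shapes zero_le_power2)
  also have "\<dots> = advantage_const C D * (M ^ D)\<^sup>2"
  proof -
    have "(X * (y * m))\<^sup>2 * (K * E) = K * E * (X * y)\<^sup>2 * m\<^sup>2" for X y m K E :: real
      by (simp add: power2_eq_square)
    thus ?thesis unfolding advantage_const_def B_def power_mult_distrib[of C M] .
  qed
  finally show ?thesis .
qed

section \<open>Signed star counts and their means\<close>

text \<open>For \<open>t \<ge> 1\<close> and two-element edges, a common vertex characterises the copies of the star with \<open>t\<close> edges;
  this form avoids isomorphisms and also makes sense inside any edge set.\<close>

definition stars :: "'b set set \<Rightarrow> nat \<Rightarrow> 'b set set set" where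
  "stars A t = {S. S \<subseteq> A \<and> card S = t \<and> (\<exists>v. \<forall>e\<in>S. v \<in> e)}"

lemma finite_stars: "finite A \<Longrightarrow> finite (stars A t)"
  unfolding stars_def by (rule finite_subset[of _ "Pow A"]) auto

lemma pairsD: "e \<in> pairs n \<Longrightarrow> card e = 2 \<and> e \<subseteq> {1..n}"
  by (auto simp: pairs_def nsets_def)

lemma graph_iso_star_imp:
  assumes iso: "graph_iso (\<Union>S, S) (star_graph t)"
  shows "card S = t \<and> (\<exists>v. \<forall>e\<in>S. v \<in> e)"
proof -
  obtain \<phi> where bij: "bij_betw \<phi> (\<Union>S) {0..t}"
    and im: "(\<lambda>e. \<phi> ` e) ` S = {{0, i} |i. i \<in> {1..t}}"
    using iso by (auto simp: graph_iso_def star_graph_def)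
  have inj: "inj_on \<phi> (\<Union>S)" using bij by (rule bij_betw_imp_inj_on)
  have "inj_on (\<lambda>e. \<phi> ` e) S"
    by (rule inj_on_subset[OF inj_on_image_Pow[OF inj]]) auto
  hence "card S = card {{0, i} |i. i \<in> {1..t}}" using im card_image by fastforce
  also have "{{0, i} |i. i \<in> {1..t}} = (\<lambda>i. {0, i}) ` {1..t}" by auto
  also have "card \<dots> = t" by (subst card_image) (auto simp: inj_on_def doubleton_eq_iff)
  finally have c: "card S = t" .
  obtain v where v: "v \<in> \<Union>S" "\<phi> v = 0"
    using bij_betw_imp_surj_on[OF bij] by (metis atLeastAtMost_iff imageE le0)
  have "v \<in> e" if e: "e \<in> S" for e
  proof -
    have "\<phi> ` e \<in> {{0, i} |i. i \<in> {1..t}}" using im e by blast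
    hence "0 \<in> \<phi> ` e" by blast
    then obtain x where x: "x \<in> e" "\<phi> x = 0" by force
    hence "x = v" using inj_onD[OF inj, of x v] v e by auto
    thus ?thesis using x by simp
  qed
  with c show ?thesis by blast
qed

lemma star_imp_graph_iso:
  assumes S: "card S = t" "1 \<le> t" and two: "\<And>e. e \<in> S \<Longrightarrow> card e = 2" and v: "\<And>e. e \<in> S \<Longrightarrow> v \<in> e"
  shows "graph_iso (\<Union>S, S) (star_graph t)"
proof -
  have fin: "finite S" using S by (intro card_ge_0_finite) auto
  have ne: "S \<noteq> {}" using S by auto
  have vU: "insert v (\<Union>S) = \<Union>S" using ne v by blast
  have cU: "card (\<Union>S) = t + 1"
    using card_insert_Union_star[OF fin, of v] two v S by (simp add: vU)
  have finU: "finite (\<Union>S)" using cU by (intro card_ge_0_finite) auto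
  have "card (\<Union>S - {v}) = card {1..t}" using cU finU vU by (subst card_Diff_singleton) auto
  then obtain g where g: "bij_betw g (\<Union>S - {v}) {1..t}"
    using finite_same_card_bij[of "\<Union>S - {v}" "{1..t}"] finU by auto
  define \<phi> where "\<phi> = g(v := 0)"
  have bij: "bij_betw \<phi> (\<Union>S) {0..t}"
  proof -
    have "bij_betw \<phi> (\<Union>S - {v}) {1..t}"
      using g by (rule bij_betw_cong[THEN iffD1, rotated]) (auto simp: \<phi>_def)
    hence "bij_betw \<phi> ((\<Union>S - {v}) \<union> {v}) ({1..t} \<union> {0})"
      by (rule bij_betw_combine) (auto simp: \<phi>_def bij_betw_def)
    moreover have "(\<Union>S - {v}) \<union> {v} = \<Union>S" using vU by blast
    moreover have "{1..t} \<union> {0} = {0..t}" by auto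
    ultimately show ?thesis by simp
  qed
  have edge: "\<exists>x\<in>\<Union>S - {v}. e = {v, x}" if e: "e \<in> S" for e
  proof -
    obtain a b where ab: "e = {a, b}" "a \<noteq> b" using two[OF e] by (auto simp: card_2_iff)
    consider "v = a" | "v = b" using v[OF e] ab by blast
    thus ?thesis
    proof cases
      case 1 thus ?thesis using ab e by (intro bexI[of _ b]) auto
    next
      case 2 thus ?thesis using ab e by (intro bexI[of _ a]) auto
    qed
  qed
  have "(\<lambda>e. \<phi> ` e) ` S = {{0, i} |i. i \<in> {1..t}}"
  proof (intro set_eqI iffI)
    fix f assume "f \<in> (\<lambda>e. \<phi> ` e) ` S"
    then obtain e where e: "e \<in> S" "f = \<phi> ` e" by blast
    obtain x where x: "x \<in> \<Union>S - {v}" "e = {v, x}" using edge[OF e(1)] by blast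
    have "f = {0, g x}" using e x by (auto simp: \<phi>_def)
    moreover have "g x \<in> {1..t}" using bij_betwE[OF g] x by blast
    ultimately show "f \<in> {{0, i} |i. i \<in> {1..t}}" by blast
  next
    fix f assume "f \<in> {{0, i} |i. i \<in> {1..t}}"
    then obtain i where i: "i \<in> {1..t}" "f = {0, i}" by blast
    have "i \<in> g ` (\<Union>S - {v})" using bij_betw_imp_surj_on[OF g] i(1) by simp
    then obtain x where x: "x \<in> \<Union>S - {v}" "g x = i" by (auto elim!: imageE)
    then obtain e where e: "e \<in> S" "x \<in> e" by blast
    obtain y where y: "y \<in> \<Union>S - {v}" "e = {v, y}" using edge[OF e(1)] by blast
    hence "e = {v, x}" using x e by auto
    hence "f = \<phi> ` e" using i x by (auto simp: \<phi>_def)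
    thus "f \<in> (\<lambda>e. \<phi> ` e) ` S" using e by blast
  qed
  with bij show ?thesis by (auto simp: graph_iso_def star_graph_def)
qed

lemma signed_count_star:
  assumes "1 \<le> t"
  shows "signed_count n p (star_graph t) G = (\<Sum>S\<in>stars (pairs n) t. fchar p S G)"
proof -
  have "{S. S \<subseteq> pairs n \<and> graph_iso (\<Union>S, S) (star_graph t)} = stars (pairs n) t"
  proof (intro set_eqI iffI)
    fix S assume "S \<in> {S. S \<subseteq> pairs n \<and> graph_iso (\<Union>S, S) (star_graph t)}"
    thus "S \<in> stars (pairs n) t" using graph_iso_star_imp[of S t] by (auto simp: stars_def)
  next
    fix S assume "S \<in> stars (pairs n) t"
    then obtain v where S: "S \<subseteq> pairs n" "card S = t" "\<forall>e\<in>S. v \<in> e" by (auto simp: stars_def)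
    have "graph_iso (\<Union>S, S) (star_graph t)"
      using S by (intro star_imp_graph_iso[where v = v] assms) (auto dest: pairsD)
    thus "S \<in> {S. S \<subseteq> pairs n \<and> graph_iso (\<Union>S, S) (star_graph t)}" using S by simp
  qed
  thus ?thesis by (simp add: signed_count_def)
qed

text \<open>This is what makes the conditional mean of the signed star count independent of the planted copy.\<close>

lemma card_stars_image:
  assumes inj: "inj_on \<phi> V" and E: "\<And>e. e \<in> E \<Longrightarrow> e \<subseteq> V" and t: "1 \<le> t"
  shows "card (stars ((\<lambda>e. \<phi> ` e) ` E) t) = card (stars E t)"
proof -
  let ?I = "\<lambda>e. \<phi> ` e"
  have injE: "inj_on ?I E"
    by (rule inj_on_subset[OF inj_on_image_Pow[OF inj]]) (use E in auto)
  have injS: "inj_on (\<lambda>S. ?I ` S) (stars E t)"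
    by (rule inj_on_subset[OF inj_on_image_Pow[OF injE]]) (auto simp: stars_def)
  have "stars (?I ` E) t = (\<lambda>S. ?I ` S) ` stars E t"
  proof (intro set_eqI iffI)
    fix S' assume "S' \<in> stars (?I ` E) t"
    then obtain w where S': "S' \<subseteq> ?I ` E" "card S' = t" "\<forall>e\<in>S'. w \<in> e" by (auto simp: stars_def)
    obtain S where S: "S \<subseteq> E" "S' = ?I ` S" using S'(1) by (auto simp: subset_image_iff)
    have c: "card S = t" using S S'(2) card_image[OF inj_on_subset[OF injE S(1)]] by simp
    hence "S \<noteq> {}" using t by auto
    then obtain e0 where e0: "e0 \<in> S" by blast
    hence "w \<in> \<phi> ` e0" using S' S by blast
    then obtain x where x: "x \<in> e0" "w = \<phi> x" by blast
    have "x \<in> e" if e: "e \<in> S" for e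
    proof -
      have "w \<in> \<phi> ` e" using S' S e by blast
      then obtain y where y: "y \<in> e" "\<phi> x = \<phi> y" unfolding x(2) by (rule imageE)
      moreover have "x \<in> V" "y \<in> V" using x e0 y e E S by blast+
      ultimately show ?thesis using inj_onD[OF inj, of x y] by simp
    qed
    hence "S \<in> stars E t" using S c by (auto simp: stars_def)
    thus "S' \<in> (\<lambda>S. ?I ` S) ` stars E t" using S by blast
  next
    fix S' assume "S' \<in> (\<lambda>S. ?I ` S) ` stars E t"
    then obtain S v where S: "S \<subseteq> E" "card S = t" "\<forall>e\<in>S. v \<in> e" "S' = ?I ` S"
      by (auto simp: stars_def)
    have "card S' = t" using S card_image[OF inj_on_subset[OF injE S(1)]] by simp
    moreover have "\<forall>e\<in>S'. \<phi> v \<in> e" "S' \<subseteq> ?I ` E" using S by auto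
    ultimately show "S' \<in> stars (?I ` E) t" by (auto simp: stars_def)
  qed
  thus ?thesis using card_image[OF injS] by simp
qed

lemma sum_degrees_image:
  assumes inj: "inj_on \<phi> V" and E: "\<And>e. e \<in> E \<Longrightarrow> e \<subseteq> V" and t: "1 \<le> t"
    and W: "finite W" "\<phi> ` V \<subseteq> W"
  shows "(\<Sum>w\<in>W. real (card {e \<in> (\<lambda>e. \<phi> ` e) ` E. w \<in> e}) ^ t)
    = (\<Sum>v\<in>V. real (card {e \<in> E. v \<in> e}) ^ t)"
proof -
  let ?I = "\<lambda>e. \<phi> ` e"
  let ?d = "\<lambda>w. real (card {e \<in> ?I ` E. w \<in> e}) ^ t"
  have injE: "inj_on ?I E"
    by (rule inj_on_subset[OF inj_on_image_Pow[OF inj]]) (use E in auto)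
  have zero: "?d w = 0" if "w \<notin> \<phi> ` V" for w
  proof -
    have "{e \<in> ?I ` E. w \<in> e} = {}" using that E by blast
    thus ?thesis using t by (simp only: card.empty of_nat_0 zero_power)
  qed
  have deg: "card {e \<in> ?I ` E. \<phi> v \<in> e} = card {e \<in> E. v \<in> e}" if v: "v \<in> V" for v
  proof -
    have "{e \<in> ?I ` E. \<phi> v \<in> e} = ?I ` {e \<in> E. v \<in> e}"
    proof (intro set_eqI iffI)
      fix f assume "f \<in> {e \<in> ?I ` E. \<phi> v \<in> e}"
      then obtain e where e: "e \<in> E" "f = \<phi> ` e" "\<phi> v \<in> \<phi> ` e" by blast
      then obtain x where x: "x \<in> e" "\<phi> v = \<phi> x" by blast
      have "v = x" using inj_onD[OF inj x(2) v] x E[OF e(1)] by blast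
      thus "f \<in> ?I ` {e \<in> E. v \<in> e}" using e x by blast
    qed blast
    thus ?thesis using card_image[OF inj_on_subset[OF injE]] by (metis (no_types, lifting) mem_Collect_eq subsetI)
  qed
  have "(\<Sum>w\<in>W. ?d w) = (\<Sum>w\<in>\<phi> ` V. ?d w)"
    by (rule sum.mono_neutral_right) (use W zero in auto)
  also have "\<dots> = (\<Sum>v\<in>V. ?d (\<phi> v))" by (simp add: sum.reindex[OF inj])
  also have "\<dots> = (\<Sum>v\<in>V. real (card {e \<in> E. v \<in> e}) ^ t)"
    by (intro sum.cong refl) (simp only: deg)
  finally show ?thesis .
qed

text \<open>Only the stars that lie inside the planted set have non-zero mean.\<close>

lemma expectation_star_overlay:
  assumes p: "0 < p" "p < 1" and t: "1 \<le> t" and E: "E \<subseteq> pairs n"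
  shows "measure_pmf.expectation (erdos_renyi n p) (\<lambda>G. signed_count n p (star_graph t) (overlay E G))
    = edge_signal p ^ t * real (card (stars E t))"
proof -
  let ?St = "stars (pairs n) t"
  have fin: "finite ?St" by (simp add: finite_stars)
  have "measure_pmf.expectation (erdos_renyi n p) (\<lambda>G. signed_count n p (star_graph t) (overlay E G))
    = (\<Sum>S\<in>?St. measure_pmf.expectation (erdos_renyi n p) (\<lambda>G. fchar p S (overlay E G)))"
    unfolding signed_count_star[OF t] by (rule expectation_sum_finite) simp
  also have "\<dots> = (\<Sum>S\<in>?St. if S \<subseteq> E then edge_signal p ^ t else 0)"
    by (intro sum.cong refl, subst expectation_fchar_overlay[OF p]) (auto simp: stars_def)
  also have "\<dots> = (\<Sum>S\<in>{S \<in> ?St. S \<subseteq> E}. edge_signal p ^ t)" using fin by (simp only: sum.inter_filter)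
  also have "{S \<in> ?St. S \<subseteq> E} = stars E t" using E by (auto simp: stars_def)
  finally show ?thesis by simp
qed

text \<open>Choosing \<open>t\<close> edges at a vertex gives a star with a marked centre, and a star has at most two possible
  centres (two when \<open>t = 1\<close>), as they all lie on one edge.\<close>

lemma sum_choose_degrees_le_card_stars:
  assumes H: "simple_graph H" and t: "1 \<le> t"
  shows "(\<Sum>v\<in>verts H. vdegree H v choose t) \<le> 2 * card (stars (edges H) t)"
proof -
  let ?St = "stars (edges H) t"
  have finE: "finite (edges H)" using H by (rule simple_graph_finite_edges)
  have finV: "finite (verts H)" using H by (simp add: simple_graph_def)
  have "(\<Sum>v\<in>verts H. vdegree H v choose t) = (\<Sum>v\<in>verts H. \<Sum>S\<in>{S \<in> ?St. \<forall>e\<in>S. v \<in> e}. 1)"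
  proof (intro sum.cong refl)
    fix v
    have "{S \<in> ?St. \<forall>e\<in>S. v \<in> e} = {S. S \<subseteq> {e \<in> edges H. v \<in> e} \<and> card S = t}"
      by (auto simp: stars_def)
    thus "vdegree H v choose t = (\<Sum>S\<in>{S \<in> ?St. \<forall>e\<in>S. v \<in> e}. 1)"
      using finE by (simp add: n_subsets vdegree_def)
  qed
  also have "\<dots> = (\<Sum>S\<in>?St. \<Sum>v\<in>{v \<in> verts H. \<forall>e\<in>S. v \<in> e}. 1)"
    by (rule sum.swap_restrict) (use finV finE in \<open>auto simp: finite_stars\<close>)
  also have "\<dots> \<le> (\<Sum>S\<in>?St. 2)"
  proof (rule sum_mono)
    fix S assume S: "S \<in> ?St"
    hence "S \<noteq> {}" using t by (auto simp: stars_def)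
    then obtain e where e: "e \<in> S" by blast
    hence "e \<in> edges H" using S by (auto simp: stars_def)
    hence c: "card e = 2" using H by (auto simp: simple_graph_def nsets_def)
    have "card {v \<in> verts H. \<forall>e\<in>S. v \<in> e} \<le> card e"
      using e c by (intro card_mono) (auto intro: card_ge_0_finite)
    thus "(\<Sum>v\<in>{v \<in> verts H. \<forall>e\<in>S. v \<in> e}. 1) \<le> (2::nat)" using c by simp
  qed
  finally show ?thesis by simp
qed

text \<open>For \<open>d \<ge> t\<close> the binomial coefficient is at least \<open>(d / t) ^ t\<close>.  Smaller degrees contribute at most \<open>t ^ t\<close>
  each, which is the second summand; it is of lower order when the ratio is large.\<close>

lemma sum_degree_powers_le_card_stars:
  assumes H: "simple_graph H" "card (verts H) \<le> n" and t: "1 \<le> t"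
  shows "(\<Sum>v\<in>verts H. real (vdegree H v) ^ t)
    \<le> 2 * real t ^ t * real (card (stars (edges H) t)) + real n * real t ^ t"
proof -
  have pt: "real d ^ t \<le> real t ^ t * real (d choose t) + real t ^ t" for d
  proof (cases "t \<le> d")
    case True
    have "(real d / real t) ^ t \<le> real (d choose t)" by (rule binomial_ge_n_over_k_pow_k[OF True])
    hence "real d ^ t / real t ^ t \<le> real (d choose t)" by (simp only: power_divide)
    hence "real d ^ t \<le> real (d choose t) * real t ^ t" using t by (simp add: pos_divide_le_eq)
    moreover have "0 \<le> real t ^ t" by simp
    ultimately show ?thesis by (subst mult.commute) linarith
  next
    case False
    hence "real d ^ t \<le> real t ^ t" by (intro power_mono) auto
    moreover have "0 \<le> real t ^ t * real (d choose t)" by simp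
    ultimately show ?thesis by linarith
  qed
  have "(\<Sum>v\<in>verts H. real (vdegree H v) ^ t)
      \<le> (\<Sum>v\<in>verts H. real t ^ t * real (vdegree H v choose t) + real t ^ t)"
    by (intro sum_mono pt)
  also have "\<dots> = real t ^ t * real (\<Sum>v\<in>verts H. vdegree H v choose t) + real (card (verts H)) * real t ^ t"
    by (simp add: sum.distrib sum_distrib_left)
  also have "\<dots> \<le> real t ^ t * real (2 * card (stars (edges H) t)) + real n * real t ^ t"
    by (intro add_mono mult_left_mono mult_right_mono of_nat_mono
          sum_choose_degrees_le_card_stars H t) auto
  finally show ?thesis by simp
qed

lemma card_subsets_le_power:
  assumes "finite A"
  shows "card {B. B \<subseteq> A \<and> card B = r} \<le> card A ^ r"
proof (cases "r \<le> card A")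
  case True
  thus ?thesis using binomial_le_pow[OF True] assms by (simp add: n_subsets)
next
  case False
  thus ?thesis using assms by (simp add: n_subsets binomial_eq_0)
qed

lemma sum_UNION_le:
  fixes f :: "'b \<Rightarrow> real"
  assumes "finite I" "\<And>i. i \<in> I \<Longrightarrow> finite (A i)" "\<And>x. 0 \<le> f x"
  shows "sum f (\<Union>i\<in>I. A i) \<le> (\<Sum>i\<in>I. sum f (A i))"
proof -
  have "sum f (\<Union>i\<in>I. A i) \<le> (\<Sum>y\<in>Sigma I A. f (snd y))"
    by (rule sum_le_included[where i = snd]) (use assms in force)+
  also have "\<dots> = (\<Sum>i\<in>I. sum f (A i))"
    using assms by (subst sum.Sigma) (auto simp: case_prod_unfold)
  finally show ?thesis .
qed

section \<open>Pairs of overlapping stars\<close>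

text \<open>Pairs of \<open>t\<close>-stars with edges taken from \<open>P\<close> and \<open>P'\<close> (later, the edges at two given centres) whose
  characters can have positive covariance when \<open>E\<close> is planted.\<close>

definition overlapping :: "'b set \<Rightarrow> 'b set \<Rightarrow> 'b set \<Rightarrow> nat \<Rightarrow> ('b set \<times> 'b set) set" where
  "overlapping P P' E t = {(S, T). S \<subseteq> P \<and> T \<subseteq> P' \<and> card S = t \<and> card T = t \<and>
     S \<inter> T \<noteq> {} \<and> sym_diff S T \<subseteq> E}"

lemma finite_overlapping: "finite P \<Longrightarrow> finite P' \<Longrightarrow> finite (overlapping P P' E t)"
  unfolding overlapping_def by (rule finite_subset[of _ "Pow P \<times> Pow P'"]) auto

lemma card_sym_diff_eq:
  assumes "finite S" "finite T" "card S = t" "card T = t"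
  shows "card (S - T) = t - card (S \<inter> T)" "card (T - S) = t - card (S \<inter> T)"
    "card (sym_diff S T) = 2 * (t - card (S \<inter> T))"
proof -
  show 1: "card (S - T) = t - card (S \<inter> T)" using assms by (simp add: card_Diff_subset_Int)
  show 2: "card (T - S) = t - card (S \<inter> T)" using assms by (simp add: card_Diff_subset_Int Int_commute)
  have "card (sym_diff S T) = card (S - T) + card (T - S)"
    using assms by (intro card_Un_disjoint) auto
  thus "card (sym_diff S T) = 2 * (t - card (S \<inter> T))" using 1 2 by simp
qed

text \<open>The pair is recovered from its intersection, of size \<open>s\<close>, and the two differences, which lie in \<open>E\<close> and
  have size \<open>t - s\<close>.\<close>

lemma overlap_sum_same_centre:
  fixes l :: real
  assumes P: "finite P" and l: "0 \<le> l"
  shows "(\<Sum>(S, T)\<in>overlapping P P E t. l ^ card (sym_diff S T))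
    \<le> (\<Sum>s\<in>{1..t}. real (card P) ^ s * (l * real (card (P \<inter> E))) ^ (2 * (t - s)))"
proof -
  let ?A = "\<lambda>s. {A. A \<subseteq> P \<and> card A = s}" and ?B = "\<lambda>s. {B. B \<subseteq> P \<inter> E \<and> card B = t - s}"
  let ?Y = "Sigma {1..t} (\<lambda>s. ?A s \<times> (?B s \<times> ?B s))"
  have finA: "finite (?A s)" for s by (rule finite_subset[of _ "Pow P"]) (use P in auto)
  have finB: "finite (?B s)" for s by (rule finite_subset[of _ "Pow P"]) (use P in auto)
  have finY: "finite ?Y" by (intro finite_SigmaI finite_cartesian_product finA finB) simp
  have "(\<Sum>x\<in>overlapping P P E t. l ^ card (sym_diff (fst x) (snd x)))
      \<le> (\<Sum>y\<in>?Y. l ^ (2 * (t - fst y)))"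
  proof (rule sum_le_included[where i = "\<lambda>(s, A, B, B'). (A \<union> B, A \<union> B')"])
    show "finite (overlapping P P E t)" using P by (intro finite_overlapping)
    show "finite ?Y" by (rule finY)
    show "\<forall>y\<in>?Y. 0 \<le> l ^ (2 * (t - fst y))" using l by simp
    show "\<forall>x\<in>overlapping P P E t. \<exists>y\<in>?Y. (case y of (s, A, B, B') \<Rightarrow> (A \<union> B, A \<union> B')) = x \<and>
        l ^ card (sym_diff (fst x) (snd x)) \<le> l ^ (2 * (t - fst y))"
    proof
      fix x assume x: "x \<in> overlapping P P E t"
      obtain S T where ST: "x = (S, T)" by (cases x)
      have h: "S \<subseteq> P" "T \<subseteq> P" "card S = t" "card T = t" "S \<inter> T \<noteq> {}" "sym_diff S T \<subseteq> E"
        using x unfolding ST overlapping_def by auto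
      have fin: "finite S" "finite T" using h P finite_subset by auto
      note c = card_sym_diff_eq[OF fin h(3,4)]
      have "1 \<le> card (S \<inter> T)" using h(5) fin by (simp add: Suc_le_eq card_gt_0_iff)
      moreover have "card (S \<inter> T) \<le> t" using card_mono[of S "S \<inter> T"] fin h(3) by simp
      ultimately have "(card (S \<inter> T), S \<inter> T, S - T, T - S) \<in> ?Y"
        using h c by auto
      moreover have "(S \<inter> T) \<union> (S - T) = S" "(S \<inter> T) \<union> (T - S) = T" by auto
      ultimately show "\<exists>y\<in>?Y. (case y of (s, A, B, B') \<Rightarrow> (A \<union> B, A \<union> B')) = x \<and>
        l ^ card (sym_diff (fst x) (snd x)) \<le> l ^ (2 * (t - fst y))"
        unfolding ST using c by (intro bexI[of _ "(card (S \<inter> T), S \<inter> T, S - T, T - S)"]) auto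
    qed
  qed
  also have "\<dots> = (\<Sum>s\<in>{1..t}. \<Sum>z\<in>?A s \<times> (?B s \<times> ?B s). l ^ (2 * (t - s)))"
    by (subst sum.Sigma)
       (auto intro!: finite_cartesian_product finA finB simp only: case_prod_unfold finite_atLeastAtMost)
  also have "\<dots> = (\<Sum>s\<in>{1..t}. real (card (?A s)) * (real (card (?B s)))\<^sup>2 * l ^ (2 * (t - s)))"
    by (simp add: card_cartesian_product power2_eq_square mult.assoc)
  also have "\<dots> \<le> (\<Sum>s\<in>{1..t}. real (card P) ^ s * (l * real (card (P \<inter> E))) ^ (2 * (t - s)))"
  proof (rule sum_mono)
    fix s
    have a: "real (card (?A s)) \<le> real (card P) ^ s"
      using card_subsets_le_power[OF P, of s] by (metis of_nat_le_iff of_nat_power)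
    have b: "real (card (?B s)) \<le> real (card (P \<inter> E)) ^ (t - s)"
      using card_subsets_le_power[of "P \<inter> E" "t - s"] P by (metis finite_Int of_nat_le_iff of_nat_power)
    have "real (card (?A s)) * (real (card (?B s)))\<^sup>2 * l ^ (2 * (t - s))
      \<le> real (card P) ^ s * (real (card (P \<inter> E)) ^ (t - s))\<^sup>2 * l ^ (2 * (t - s))"
      using l by (intro mult_right_mono mult_mono a power_mono b) auto
    also have "\<dots> = real (card P) ^ s * (l * real (card (P \<inter> E))) ^ (2 * (t - s))"
      by (simp add: power_mult_distrib power_mult[symmetric] mult.commute)
    finally show "real (card (?A s)) * (real (card (?B s)))\<^sup>2 * l ^ (2 * (t - s))
      \<le> real (card P) ^ s * (l * real (card (P \<inter> E))) ^ (2 * (t - s))" .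
  qed
  finally show ?thesis by (simp add: case_prod_unfold)
qed

text \<open>Two stars with distinct centres can only share the edge \<open>e\<close> between the centres, so all their other
  edges lie in \<open>E\<close>.\<close>

lemma overlap_sum_distinct_centres:
  fixes l :: real
  assumes P: "finite P" "finite P'" and e: "P \<inter> P' \<subseteq> {e}" and l: "0 \<le> l"
  shows "(\<Sum>(S, T)\<in>overlapping P P' E t. l ^ card (sym_diff S T))
    \<le> (l * real (card (P \<inter> E))) ^ (t - 1) * (l * real (card (P' \<inter> E))) ^ (t - 1)"
proof -
  let ?B = "\<lambda>P. {B. B \<subseteq> P \<inter> E \<and> card B = t - 1}"
  have finB: "finite (?B Q)" if "finite Q" for Q
    by (rule finite_subset[of _ "Pow Q"]) (use that in auto)
  have "(\<Sum>x\<in>overlapping P P' E t. l ^ card (sym_diff (fst x) (snd x)))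
      \<le> (\<Sum>y\<in>?B P \<times> ?B P'. l ^ (2 * (t - 1)))"
  proof (rule sum_le_included[where i = "\<lambda>(B, B'). (insert e B, insert e B')"])
    show "finite (overlapping P P' E t)" using P by (rule finite_overlapping)
    show "finite (?B P \<times> ?B P')" using P by (intro finite_cartesian_product finB)
    show "\<forall>y\<in>?B P \<times> ?B P'. 0 \<le> l ^ (2 * (t - 1))" using l by simp
    show "\<forall>x\<in>overlapping P P' E t. \<exists>y\<in>?B P \<times> ?B P'. (case y of (B, B') \<Rightarrow> (insert e B, insert e B')) = x \<and>
        l ^ card (sym_diff (fst x) (snd x)) \<le> l ^ (2 * (t - 1))"
    proof
      fix x assume x: "x \<in> overlapping P P' E t"
      obtain S T where ST: "x = (S, T)" by (cases x)
      have h: "S \<subseteq> P" "T \<subseteq> P'" "card S = t" "card T = t" "S \<inter> T \<noteq> {}" "sym_diff S T \<subseteq> E"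
        using x unfolding ST overlapping_def by auto
      have fin: "finite S" "finite T" using h P finite_subset by auto
      have I: "S \<inter> T = {e}" using h(1,2,5) e by blast
      note c = card_sym_diff_eq[OF fin h(3,4), unfolded I]
      have "(S - T, T - S) \<in> ?B P \<times> ?B P'" using h c by auto
      moreover have "insert e (S - T) = S" "insert e (T - S) = T" using I by auto
      ultimately show "\<exists>y\<in>?B P \<times> ?B P'. (case y of (B, B') \<Rightarrow> (insert e B, insert e B')) = x \<and>
        l ^ card (sym_diff (fst x) (snd x)) \<le> l ^ (2 * (t - 1))"
        unfolding ST using c by (intro bexI[of _ "(S - T, T - S)"]) auto
    qed
  qed
  also have "\<dots> = real (card (?B P)) * real (card (?B P')) * l ^ (2 * (t - 1))"
    by (simp add: card_cartesian_product)
  also have "\<dots> \<le> real (card (P \<inter> E)) ^ (t - 1) * real (card (P' \<inter> E)) ^ (t - 1) * l ^ (2 * (t - 1))"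
  proof -
    have b: "real (card (?B Q)) \<le> real (card (Q \<inter> E)) ^ (t - 1)" if "finite Q" for Q
      using card_subsets_le_power[of "Q \<inter> E" "t - 1"] that by (metis finite_Int of_nat_le_iff of_nat_power)
    show ?thesis using l P by (intro mult_right_mono mult_mono b) auto
  qed
  also have "\<dots> = (l * real (card (P \<inter> E))) ^ (t - 1) * (l * real (card (P' \<inter> E))) ^ (t - 1)"
    by (simp add: power_mult_distrib mult_2 power_add)
  finally show ?thesis by (simp add: case_prod_unfold)
qed

lemma card_pairs_at_le:
  assumes "v \<in> {1..n}"
  shows "card {e \<in> pairs n. v \<in> e} \<le> n"
proof -
  let ?P = "{e \<in> pairs n. v \<in> e}"
  have "card ?P + 1 = card (insert v (\<Union>?P))"
    by (subst card_insert_Union_star) (auto dest: pairsD)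
  also have "\<dots> \<le> card {1..n}"
  proof (rule card_mono)
    show "insert v (\<Union>?P) \<subseteq> {1..n}" using assms pairsD by blast
  qed simp
  finally show ?thesis by simp
qed

lemma overlap_sum_stars:
  fixes l :: real
  assumes E: "E \<subseteq> pairs n" and l: "0 \<le> l" and t: "1 \<le> t"
  defines "x \<equiv> \<lambda>v. l * real (card {e \<in> E. v \<in> e})"
  shows "(\<Sum>S\<in>stars (pairs n) t. \<Sum>T\<in>stars (pairs n) t.
           if S \<inter> T \<noteq> {} \<and> sym_diff S T \<subseteq> E then l ^ card (sym_diff S T) else 0)
    \<le> (\<Sum>v\<in>{1..n}. \<Sum>s\<in>{1..t}. real n ^ s * x v ^ (2 * (t - s))) + (\<Sum>v\<in>{1..n}. x v ^ (t - 1))\<^sup>2"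
proof -
  let ?St = "stars (pairs n) t"
  define P where "P = (\<lambda>v. {e \<in> pairs n. v \<in> e})"
  define Y where "Y = (\<lambda>v. \<Sum>s\<in>{1..t}. real n ^ s * x v ^ (2 * (t - s)))"
  define f where "f = (\<lambda>z :: nat set set \<times> nat set set. l ^ card (sym_diff (fst z) (snd z)))"
  have f0: "0 \<le> f z" for z using l by (simp add: f_def)
  have finP: "finite (P v)" for v by (simp add: P_def)
  have PE: "P v \<inter> E = {e \<in> E. v \<in> e}" for v using E by (auto simp: P_def)
  have x0: "0 \<le> x v" for v using l by (simp add: x_def)
  have "(\<Sum>S\<in>?St. \<Sum>T\<in>?St.
           if S \<inter> T \<noteq> {} \<and> sym_diff S T \<subseteq> E then l ^ card (sym_diff S T) else 0)
      = (\<Sum>z\<in>?St \<times> ?St. if fst z \<inter> snd z \<noteq> {} \<and> sym_diff (fst z) (snd z) \<subseteq> E then f z else 0)"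
    unfolding f_def sum.cartesian_product case_prod_unfold ..
  also have "\<dots> = sum f {z \<in> ?St \<times> ?St. fst z \<inter> snd z \<noteq> {} \<and> sym_diff (fst z) (snd z) \<subseteq> E}"
    by (rule sum.inter_filter[symmetric]) (simp add: finite_stars)
  also have "\<dots> \<le> sum f (\<Union>z\<in>{1..n} \<times> {1..n}. overlapping (P (fst z)) (P (snd z)) E t)"
  proof (rule sum_mono2)
    show "finite (\<Union>z\<in>{1..n} \<times> {1..n}. overlapping (P (fst z)) (P (snd z)) E t)"
      by (intro finite_UN_I finite_overlapping finP) auto
    have cen: "\<exists>v\<in>{1..n}. S \<subseteq> P v" if S: "S \<in> ?St" for S
    proof -
      obtain v where v: "S \<subseteq> pairs n" "card S = t" "\<forall>e\<in>S. v \<in> e" using S by (auto simp: stars_def)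
      have "S \<noteq> {}" using v(2) t by auto
      then obtain e where "e \<in> S" by blast
      hence "v \<in> e" "e \<in> pairs n" using v by auto
      hence "v \<in> {1..n}" using pairsD by blast
      thus ?thesis using v by (auto simp: P_def)
    qed
    show "{z \<in> ?St \<times> ?St. fst z \<inter> snd z \<noteq> {} \<and> sym_diff (fst z) (snd z) \<subseteq> E}
        \<subseteq> (\<Union>z\<in>{1..n} \<times> {1..n}. overlapping (P (fst z)) (P (snd z)) E t)"
    proof
      fix z assume z: "z \<in> {z \<in> ?St \<times> ?St. fst z \<inter> snd z \<noteq> {} \<and> sym_diff (fst z) (snd z) \<subseteq> E}"
      hence fz: "fst z \<in> ?St" "snd z \<in> ?St" by auto
      obtain v where v: "v \<in> {1..n}" "fst z \<subseteq> P v" using cen[OF fz(1)] by blast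
      obtain w where w: "w \<in> {1..n}" "snd z \<subseteq> P w" using cen[OF fz(2)] by blast
      have "z \<in> overlapping (P (fst (v, w))) (P (snd (v, w))) E t"
        using z v w by (auto simp: overlapping_def case_prod_unfold stars_def)
      moreover have "(v, w) \<in> {1..n} \<times> {1..n}" using v w by simp
      ultimately show "z \<in> (\<Union>z\<in>{1..n} \<times> {1..n}. overlapping (P (fst z)) (P (snd z)) E t)"
        by (rule UN_I[rotated])
    qed
  qed (rule f0)
  also have "\<dots> \<le> (\<Sum>z\<in>{1..n} \<times> {1..n}. sum f (overlapping (P (fst z)) (P (snd z)) E t))"
    by (rule sum_UNION_le) (auto intro: finite_overlapping finP f0)
  also have "\<dots> \<le> (\<Sum>z\<in>{1..n} \<times> {1..n}. (if fst z = snd z then Y (fst z) else 0)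
      + x (fst z) ^ (t - 1) * x (snd z) ^ (t - 1))"
  proof (rule sum_mono)
    fix z assume z: "z \<in> {1..n} \<times> {1..n}"
    define v w where "v = fst z" and "w = snd z"
    have vw: "v \<in> {1..n}" "w \<in> {1..n}" using z by (auto simp: v_def w_def)
    have "sum f (overlapping (P v) (P w) E t)
        \<le> (if v = w then Y v else 0) + x v ^ (t - 1) * x w ^ (t - 1)"
    proof (cases "v = w")
      case True
      have "sum f (overlapping (P v) (P v) E t)
          \<le> (\<Sum>s\<in>{1..t}. real (card (P v)) ^ s * x v ^ (2 * (t - s)))"
        using overlap_sum_same_centre[OF finP l, of v E t] by (simp add: f_def case_prod_unfold PE x_def)
      also have "\<dots> \<le> Y v"
        unfolding Y_def
        by (intro sum_mono mult_right_mono power_mono of_nat_mono zero_le_power x0 of_nat_0_le_iff)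
           (use card_pairs_at_le[OF vw(1)] in \<open>simp add: P_def\<close>)
      finally have "sum f (overlapping (P v) (P v) E t) \<le> Y v" .
      moreover have "0 \<le> x v ^ (t - 1) * x v ^ (t - 1)" by (simp add: x0)
      ultimately show ?thesis unfolding True[symmetric] if_P[OF refl] by linarith
    next
      case False
      have "P v \<inter> P w \<subseteq> {{v, w}}"
      proof
        fix e assume "e \<in> P v \<inter> P w"
        hence "v \<in> e" "w \<in> e" "card e = 2" using pairsD by (auto simp: P_def)
        thus "e \<in> {{v, w}}" using False by (auto simp: card_2_iff)
      qed
      from overlap_sum_distinct_centres[OF finP finP this l, of E t] False
      show ?thesis by (simp add: f_def case_prod_unfold PE x_def)
    qed
    thus "sum f (overlapping (P (fst z)) (P (snd z)) E t)
        \<le> (if fst z = snd z then Y (fst z) else 0) + x (fst z) ^ (t - 1) * x (snd z) ^ (t - 1)"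
      unfolding v_def w_def .
  qed
  also have "\<dots> = (\<Sum>v\<in>{1..n}. \<Sum>w\<in>{1..n}. (if v = w then Y v else 0) + x v ^ (t - 1) * x w ^ (t - 1))"
    by (simp only: sum.cartesian_product case_prod_unfold)
  also have "\<dots> = (\<Sum>v\<in>{1..n}. Y v) + (\<Sum>v\<in>{1..n}. x v ^ (t - 1))\<^sup>2"
    by (simp add: sum.distrib power2_eq_square sum_product)
  finally show ?thesis by (simp add: Y_def)
qed

text \<open>Compare \<open>y\<close> with \<open>K * N\<close>: in one case \<open>y\<close> is replaced by \<open>K * N\<close>, in the other \<open>N\<close> by \<open>y / K\<close>.\<close>

lemma power_product_interpolation:
  fixes y N K :: real
  assumes "0 \<le> y" "0 \<le> N" "1 \<le> K" "1 \<le> s" "s \<le> t"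
  shows "N ^ s * y ^ (t - s) \<le> K ^ t * N ^ t + y ^ t / K"
proof (cases "y \<le> K * N")
  case True
  have "N ^ s * y ^ (t - s) \<le> N ^ s * (K * N) ^ (t - s)"
    using assms True by (intro mult_left_mono power_mono) auto
  also have "\<dots> = K ^ (t - s) * (N ^ s * N ^ (t - s))" by (simp add: power_mult_distrib)
  also have "N ^ s * N ^ (t - s) = N ^ t" using assms by (simp flip: power_add)
  also have "K ^ (t - s) * N ^ t \<le> K ^ t * N ^ t"
    using assms by (intro mult_right_mono power_increasing) auto
  finally show ?thesis using assms by (simp add: add_increasing2)
next
  case False
  have "N ^ s * y ^ (t - s) \<le> (y / K) ^ s * y ^ (t - s)"
    using assms False by (intro mult_right_mono power_mono) (auto simp: pos_le_divide_eq mult.commute)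
  also have "\<dots> = (y ^ s * y ^ (t - s)) / K ^ s" by (simp add: power_divide)
  also have "y ^ s * y ^ (t - s) = y ^ t" using assms by (simp flip: power_add)
  also have "y ^ t / K ^ s \<le> y ^ t / K"
  proof (rule divide_left_mono)
    show "K \<le> K ^ s" using assms self_le_power[of K s] by simp
  qed (use assms in auto)
  finally show ?thesis using assms by (simp add: add_increasing)
qed

lemma power_pred_interpolation:
  fixes x N :: real
  assumes "0 \<le> x" "0 < N" "1 \<le> t"
  shows "x ^ (t - 1) \<le> N ^ (t - 1) + x ^ t / N"
proof (cases "x \<le> N")
  case True
  hence "x ^ (t - 1) \<le> N ^ (t - 1)" using assms by (intro power_mono)
  moreover have "0 \<le> x ^ t / N" using assms by simp
  ultimately show ?thesis by linarith
next
  case False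
  have "x ^ (t - 1) * N \<le> x ^ (t - 1) * x" using assms False by (intro mult_left_mono) auto
  also have "\<dots> = x ^ t" using assms by (simp add: power_minus_mult del: One_nat_def)
  finally have "x ^ (t - 1) \<le> x ^ t / N" using assms by (simp add: pos_le_divide_eq)
  moreover have "0 \<le> N ^ (t - 1)" using assms by simp
  ultimately show ?thesis by linarith
qed

lemma sum_squares_le_square_sum:
  fixes f :: "'b \<Rightarrow> real"
  assumes "finite A" "\<And>a. a \<in> A \<Longrightarrow> 0 \<le> f a"
  shows "(\<Sum>a\<in>A. (f a)\<^sup>2) \<le> (\<Sum>a\<in>A. f a)\<^sup>2"
proof -
  have "(\<Sum>a\<in>A. (f a)\<^sup>2) \<le> (\<Sum>a\<in>A. f a * (\<Sum>b\<in>A. f b))"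
    unfolding power2_eq_square
    by (intro sum_mono mult_left_mono member_le_sum assms) auto
  also have "\<dots> = (\<Sum>a\<in>A. f a)\<^sup>2" by (simp add: sum_distrib_right power2_eq_square)
  finally show ?thesis .
qed

text \<open>The same-centre terms are interpolated with \<open>y = x\<^sub>v\<^sup>2\<close>, and the sum of the \<open>x\<^sub>v ^ (2 * t)\<close> is at most the square
  of the sum of the \<open>x\<^sub>v ^ t\<close>.  The distinct-centre term is interpolated at the threshold \<open>sqrt n\<close>, which gives
  the error \<open>A\<^sup>2 / n\<close>; this is where \<open>K \<le> n\<close> enters.\<close>

lemma overlap_power_sums_le:
  fixes x :: "nat \<Rightarrow> real" and K :: real
  assumes x: "\<And>v. 0 \<le> x v" and K: "1 \<le> K" "K \<le> real n" and t: "1 \<le> t"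
  defines "A \<equiv> \<Sum>v\<in>{1..n}. x v ^ t"
  shows "(\<Sum>v\<in>{1..n}. \<Sum>s\<in>{1..t}. real n ^ s * x v ^ (2 * (t - s))) + (\<Sum>v\<in>{1..n}. x v ^ (t - 1))\<^sup>2
    \<le> real (t + 2) * (K ^ t * real n ^ (t + 1) + A\<^sup>2 / K)"
proof -
  define N where "N = sqrt (real n)"
  have n: "0 < real n" using K by linarith
  have N: "0 < N" "N\<^sup>2 = real n" using n by (auto simp: N_def)
  have A0: "0 \<le> A" unfolding A_def by (intro sum_nonneg zero_le_power x)
  have "(\<Sum>v\<in>{1..n}. \<Sum>s\<in>{1..t}. real n ^ s * x v ^ (2 * (t - s)))
      \<le> (\<Sum>v\<in>{1..n}. \<Sum>s\<in>{1..t}. K ^ t * real n ^ t + (x v ^ t)\<^sup>2 / K)"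
  proof (intro sum_mono)
    fix v s assume s: "s \<in> {1..t}"
    have "real n ^ s * ((x v)\<^sup>2) ^ (t - s) \<le> K ^ t * real n ^ t + ((x v)\<^sup>2) ^ t / K"
      using s K x by (intro power_product_interpolation) auto
    thus "real n ^ s * x v ^ (2 * (t - s)) \<le> K ^ t * real n ^ t + (x v ^ t)\<^sup>2 / K"
      by (simp only: power_mult[symmetric] mult.commute)
  qed
  also have "\<dots> = real t * (K ^ t * real n ^ (t + 1) + (\<Sum>v\<in>{1..n}. (x v ^ t)\<^sup>2) / K)"
    by (simp add: sum.distrib sum_divide_distrib sum_distrib_left algebra_simps)
  also have "\<dots> \<le> real t * (K ^ t * real n ^ (t + 1) + A\<^sup>2 / K)"
    unfolding A_def using K x
    by (intro mult_left_mono add_left_mono divide_right_mono sum_squares_le_square_sum) auto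
  finally have 1: "(\<Sum>v\<in>{1..n}. \<Sum>s\<in>{1..t}. real n ^ s * x v ^ (2 * (t - s)))
      \<le> real t * (K ^ t * real n ^ (t + 1) + A\<^sup>2 / K)" .
  have "(\<Sum>v\<in>{1..n}. x v ^ (t - 1)) \<le> (\<Sum>v\<in>{1..n}. N ^ (t - 1) + x v ^ t / N)"
    using x N t by (intro sum_mono power_pred_interpolation) auto
  also have "\<dots> = real n * N ^ (t - 1) + A / N"
    by (simp add: sum.distrib A_def sum_divide_distrib)
  also have "real n * N ^ (t - 1) = N ^ (t + 1)"
  proof -
    have "real n * N ^ (t - 1) = N ^ (2 + (t - 1))" unfolding N(2)[symmetric] power_add ..
    also have "2 + (t - 1) = t + 1" using t by simp
    finally show ?thesis .
  qed
  finally have "(\<Sum>v\<in>{1..n}. x v ^ (t - 1)) \<le> N ^ (t + 1) + A / N" .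
  hence "(\<Sum>v\<in>{1..n}. x v ^ (t - 1))\<^sup>2 \<le> (N ^ (t + 1) + A / N)\<^sup>2"
    by (intro power_mono sum_nonneg zero_le_power x)
  also have "\<dots> \<le> 2 * ((N ^ (t + 1))\<^sup>2 + (A / N)\<^sup>2)"
    using sum_squares_bound[of "N ^ (t + 1)" "A / N"] by (simp add: power2_sum)
  also have "(N ^ (t + 1))\<^sup>2 = real n ^ (t + 1)"
    by (simp only: N(2)[symmetric] power_mult[symmetric] mult.commute)
  also have "(A / N)\<^sup>2 = A\<^sup>2 / real n" by (simp only: power_divide N(2))
  also have "2 * (real n ^ (t + 1) + A\<^sup>2 / real n) \<le> 2 * (K ^ t * real n ^ (t + 1) + A\<^sup>2 / K)"
  proof (intro mult_left_mono add_mono)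
    have "1 * real n ^ (t + 1) \<le> K ^ t * real n ^ (t + 1)"
      using K by (intro mult_right_mono one_le_power) auto
    thus "real n ^ (t + 1) \<le> K ^ t * real n ^ (t + 1)" by simp
    show "A\<^sup>2 / real n \<le> A\<^sup>2 / K" using K n by (intro divide_left_mono) auto
  qed simp
  finally have 2: "(\<Sum>v\<in>{1..n}. x v ^ (t - 1))\<^sup>2 \<le> 2 * (K ^ t * real n ^ (t + 1) + A\<^sup>2 / K)" .
  have "real (t + 2) * z = real t * z + 2 * z" for z :: real by (simp add: algebra_simps)
  from this[of "K ^ t * real n ^ (t + 1) + A\<^sup>2 / K"] 1 2 show ?thesis by linarith
qed

section \<open>Separation by a signed star count\<close>

lemma variance_finite_support:
  fixes f :: "'b \<Rightarrow> real"
  assumes "finite (set_pmf M)"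
  shows "measure_pmf.variance M f
    = measure_pmf.expectation M (\<lambda>x. (f x)\<^sup>2) - (measure_pmf.expectation M f)\<^sup>2"
  by (intro prob_space.variance_eq[OF measure_pmf.prob_space_axioms] integrable_measure_pmf_finite assms)

text \<open>The covariance of two characters is at most \<open>0\<close> unless the pair is overlapping.  In the remaining cases it is
  at most its second-moment part, in which the common planted edges contribute at most \<open>C ^ (2 * t)\<close>.
  With \<open>E = {}\<close> the bound covers the null model.\<close>

lemma conditional_variance_star_le:
  fixes K C :: real
  assumes p: "0 < p" "p < 1" and t: "1 \<le> t" and E: "E \<subseteq> pairs n"
    and C: "edge_signal p \<le> C" "1 \<le> C" and K: "1 \<le> K" "K \<le> real n"
  defines "f \<equiv> signed_count n p (star_graph t)"
    and "A \<equiv> edge_signal p ^ t * (\<Sum>v\<in>{1..n}. real (card {e \<in> E. v \<in> e}) ^ t)"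
  shows "measure_pmf.expectation (erdos_renyi n p) (\<lambda>G. (f (overlay E G))\<^sup>2)
      - (measure_pmf.expectation (erdos_renyi n p) (\<lambda>G. f (overlay E G)))\<^sup>2
    \<le> C ^ (2 * t) * (real (t + 2) * (K ^ t * real n ^ (t + 1) + A\<^sup>2 / K))"
proof -
  define l where "l = edge_signal p"
  let ?St = "stars (pairs n) t"
  let ?EQ = "measure_pmf.expectation (erdos_renyi n p)"
  define m where "m = (\<lambda>S. if S \<subseteq> E then l ^ t else 0)"
  define w where "w = (\<lambda>S T. if S \<inter> T \<noteq> {} \<and> sym_diff S T \<subseteq> E then l ^ card (sym_diff S T) else 0)"
  have l0: "0 \<le> l" using edge_signal_pos[OF p] by (simp add: l_def)
  have lC: "l \<le> C" using C by (simp add: l_def)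
  have m0: "0 \<le> m S" for S using l0 by (simp add: m_def)
  have St: "S \<subseteq> pairs n" "card S = t" "finite S" if "S \<in> ?St" for S
    using that finite_subset[OF _ finite_pairs] by (auto simp: stars_def)
  have Ef: "?EQ (\<lambda>G. f (overlay E G)) = (\<Sum>S\<in>?St. m S)"
    unfolding f_def signed_count_star[OF t] m_def l_def
    by (subst expectation_sum_finite, simp, intro sum.cong refl, subst expectation_fchar_overlay[OF p])
       (auto simp: St)
  have "?EQ (\<lambda>G. (f (overlay E G))\<^sup>2)
      = (\<Sum>S\<in>?St. \<Sum>T\<in>?St. ?EQ (\<lambda>G. fchar p S (overlay E G) * fchar p T (overlay E G)))"
    unfolding f_def signed_count_star[OF t] power2_eq_square sum_product
    by (simp add: expectation_sum_finite)
  hence "?EQ (\<lambda>G. (f (overlay E G))\<^sup>2) - (?EQ (\<lambda>G. f (overlay E G)))\<^sup>2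
      = (\<Sum>S\<in>?St. \<Sum>T\<in>?St. ?EQ (\<lambda>G. fchar p S (overlay E G) * fchar p T (overlay E G)) - m S * m T)"
    unfolding Ef by (simp add: power2_eq_square sum_product sum_subtractf)
  also have "\<dots> \<le> (\<Sum>S\<in>?St. \<Sum>T\<in>?St. C ^ (2 * t) * w S T)"
  proof (intro sum_mono)
    fix S T assume S: "S \<in> ?St" and T: "T \<in> ?St"
    note eq = expectation_fchar_overlay_mult[OF p St(1)[OF S] St(1)[OF T], of E, folded l_def]
    show "?EQ (\<lambda>G. fchar p S (overlay E G) * fchar p T (overlay E G)) - m S * m T \<le> C ^ (2 * t) * w S T"
    proof (cases "S \<inter> T = {} \<or> \<not> sym_diff S T \<subseteq> E")
      case True
      have "?EQ (\<lambda>G. fchar p S (overlay E G) * fchar p T (overlay E G)) \<le> m S * m T"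
      proof (cases "sym_diff S T \<subseteq> E")
        case sd: True
        hence I: "S \<inter> T = {}" using True by simp
        have "card (sym_diff S T) = 2 * t"
          using card_sym_diff_eq(3)[OF St(3)[OF S] St(3)[OF T] St(2)[OF S] St(2)[OF T]] I by simp
        moreover have "S \<subseteq> E" "T \<subseteq> E" using sd I by auto
        ultimately show ?thesis unfolding eq using sd I
          by (simp add: m_def mult_2 power_add)
      next
        case sd: False
        show ?thesis unfolding eq if_not_P[OF sd] by (intro mult_nonneg_nonneg m0)
      qed
      moreover have "w S T = 0" using True by (auto simp: w_def)
      ultimately show ?thesis by simp
    next
      case False
      have "card (S \<inter> T \<inter> E) \<le> t"
        using card_mono[of S "S \<inter> T \<inter> E"] St[OF S] by auto
      have "l ^ (2 * card (S \<inter> T \<inter> E)) \<le> C ^ (2 * card (S \<inter> T \<inter> E))"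
        using l0 lC by (intro power_mono)
      also have "\<dots> \<le> C ^ (2 * t)"
        using C(2) \<open>card (S \<inter> T \<inter> E) \<le> t\<close> by (intro power_increasing) auto
      finally have "l ^ card (sym_diff S T) * l ^ (2 * card (S \<inter> T \<inter> E)) \<le> l ^ card (sym_diff S T) * C ^ (2 * t)"
        using l0 by (intro mult_left_mono) auto
      moreover have "0 \<le> m S * m T" using m0 by simp
      moreover have "w S T = l ^ card (sym_diff S T)" using False by (simp add: w_def)
      ultimately show ?thesis unfolding eq using False by (simp add: mult.commute)
    qed
  qed
  also have "\<dots> = C ^ (2 * t) * (\<Sum>S\<in>?St. \<Sum>T\<in>?St. w S T)" by (simp only: sum_distrib_left)
  also have "\<dots> \<le> C ^ (2 * t) * (real (t + 2) * (K ^ t * real n ^ (t + 1) + A\<^sup>2 / K))"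
  proof (rule mult_left_mono)
    define x where "x = (\<lambda>v. l * real (card {e \<in> E. v \<in> e}))"
    have "(\<Sum>S\<in>?St. \<Sum>T\<in>?St. w S T)
        \<le> (\<Sum>v\<in>{1..n}. \<Sum>s\<in>{1..t}. real n ^ s * x v ^ (2 * (t - s))) + (\<Sum>v\<in>{1..n}. x v ^ (t - 1))\<^sup>2"
      unfolding w_def x_def by (rule overlap_sum_stars[OF E l0 t])
    also have "\<dots> \<le> real (t + 2) * (K ^ t * real n ^ (t + 1) + (\<Sum>v\<in>{1..n}. x v ^ t)\<^sup>2 / K)"
      by (rule overlap_power_sums_le[OF _ K t]) (simp add: x_def l0)
    also have "(\<Sum>v\<in>{1..n}. x v ^ t) = A"
      by (simp add: x_def A_def l_def power_mult_distrib sum_distrib_left)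
    finally show "(\<Sum>S\<in>?St. \<Sum>T\<in>?St. w S T)
        \<le> real (t + 2) * (K ^ t * real n ^ (t + 1) + A\<^sup>2 / K)" .
  qed (use C in simp)
  finally show ?thesis .
qed

definition separation_const :: "real \<Rightarrow> nat \<Rightarrow> real" where
  "separation_const C T = 16 * (real T ^ T)\<^sup>2 * C ^ (2 * T) * real (T + 2)"

text \<open>With \<open>A = R * sqrt n ^ (t + 1)\<close>, the lower bound on \<open>R\<close> makes the low-degree vertices account for at most
  half of \<open>A\<close>, so the planted mean is at least a constant times \<open>A\<close>.  The variance bound reads
  \<open>K ^ t * A\<^sup>2 / R\<^sup>2 + A\<^sup>2 / K\<close> up to constants, because \<open>n ^ (t + 1) = A\<^sup>2 / R\<^sup>2\<close>.  As the conditional mean is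
  constant, no variance comes from the choice of the copy.\<close>

lemma star_count_separation:
  fixes K C :: real
  assumes p: "0 < p" "p < 1" and H: "simple_graph H" "card (verts H) \<le> n"
    and C: "edge_signal p \<le> C" "1 \<le> C" and K: "1 \<le> K" "K \<le> real n" and t: "1 \<le> t" "t \<le> T"
  defines "R \<equiv> star_ratio n p H t" and "f \<equiv> signed_count n p (star_graph t)"
  defines "\<Delta> \<equiv> \<bar>measure_pmf.expectation (planted n p H) f - measure_pmf.expectation (erdos_renyi n p) f\<bar>"
  assumes R: "2 * (real T * C) ^ T \<le> R"
  shows "\<Delta> > 0"
    and "measure_pmf.variance (planted n p H) f \<le> separation_const C T * (K ^ T / R\<^sup>2 + 1 / K) * \<Delta>\<^sup>2"
    and "measure_pmf.variance (erdos_renyi n p) f \<le> separation_const C T * (K ^ T / R\<^sup>2 + 1 / K) * \<Delta>\<^sup>2"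
proof -
  define N where "N = sqrt (real n)"
  define l where "l = edge_signal p"
  define A where "A = l ^ t * (\<Sum>v\<in>verts H. real (vdegree H v) ^ t)"
  define \<mu> where "\<mu> = l ^ t * real (card (stars (edges H) t))"
  let ?EQ = "measure_pmf.expectation (erdos_renyi n p)"
  let ?copy = "random_copy n H"
  have n: "0 < n" using K by (cases n) auto
  have N: "1 \<le> N" "N\<^sup>2 = real n" using n by (auto simp: N_def)
  have l0: "0 < l" using edge_signal_pos[OF p] by (simp add: l_def)
  have lC: "l \<le> C" using C by (simp add: l_def)
  have T: "1 \<le> real T" using t by simp
  have TC: "1 \<le> real T * C" using mult_mono[of 1 "real T" 1 C] T C by simp
  have R1: "2 \<le> R" using R one_le_power[OF TC, of T] by linarith
  have AR: "A = R * N ^ (t + 1)"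
    unfolding A_def l_def R_def N_def by (rule star_ratio_eq[OF p n])
  have Npos: "0 < N ^ (t + 1)" using N by simp
  have A0: "0 < A" unfolding AR using R1 Npos by (intro mult_pos_pos) auto
  have tT: "real t ^ t \<le> real T ^ T"
  proof -
    have "real t ^ t \<le> real T ^ t" using t by (intro power_mono) auto
    also have "\<dots> \<le> real T ^ T" using t T by (intro power_increasing)
    finally show ?thesis .
  qed
  have tlT: "real t ^ t * l ^ t \<le> (real T * C) ^ T"
  proof -
    have "real t ^ t * l ^ t = (real t * l) ^ t" by (simp only: power_mult_distrib)
    also have "\<dots> \<le> (real T * C) ^ t" using t l0 lC by (intro power_mono mult_mono) auto
    also have "\<dots> \<le> (real T * C) ^ T" using t TC by (intro power_increasing)
    finally show ?thesis .
  qed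
  have nN: "real n \<le> N ^ (t + 1)"
    unfolding N(2)[symmetric] using t N by (intro power_increasing) auto
  have Amu: "A \<le> 4 * real T ^ T * \<mu>"
  proof -
    have "A \<le> l ^ t * (2 * real t ^ t * real (card (stars (edges H) t)) + real n * real t ^ t)"
      unfolding A_def using l0 by (intro mult_left_mono sum_degree_powers_le_card_stars H t) auto
    also have "\<dots> = 2 * (real t ^ t * \<mu>) + real n * (real t ^ t * l ^ t)"
      by (simp add: \<mu>_def algebra_simps)
    also have "\<dots> \<le> 2 * (real T ^ T * \<mu>) + N ^ (t + 1) * (real T * C) ^ T"
      using l0 nN Npos
      by (intro add_mono mult_left_mono[of _ _ 2] mult_right_mono[of _ _ \<mu>] mult_mono tT tlT)
         (auto simp: \<mu>_def)
    also have "N ^ (t + 1) * (real T * C) ^ T \<le> N ^ (t + 1) * (R / 2)"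
      using R Npos by (intro mult_left_mono) auto
    also have "N ^ (t + 1) * (R / 2) = A / 2" by (simp add: AR)
    finally show ?thesis by simp
  qed
  have mu0: "0 < \<mu>"
  proof (rule ccontr)
    assume "\<not> 0 < \<mu>"
    hence "4 * real T ^ T * \<mu> \<le> 0" by (intro mult_nonneg_nonpos) auto
    thus False using Amu A0 by linarith
  qed
  have EQ0: "?EQ f = 0"
  proof -
    have "stars ({} :: nat set set) t = {}" using t by (auto simp: stars_def)
    thus ?thesis using expectation_star_overlay[OF p t(1), of "{}" n] by (simp add: f_def)
  qed
  \<comment> \<open>mean and degree sum are the same for every copy\<close>
  have copyE: "?EQ (\<lambda>G. f (overlay E G)) = \<mu>"
      "E \<subseteq> pairs n" "l ^ t * (\<Sum>v\<in>{1..n}. real (card {e \<in> E. v \<in> e}) ^ t) = A"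
    if E: "E \<in> set_pmf ?copy" for E
  proof -
    obtain \<phi> where \<phi>: "\<phi> \<in> verts H \<rightarrow> {1..n}" "inj_on \<phi> (verts H)" "E = (\<lambda>e. \<phi> ` e) ` edges H"
      "E \<subseteq> pairs n"
      by (rule set_random_copyE[OF H E])
    have sub: "e \<subseteq> verts H" if "e \<in> edges H" for e
      using that H by (auto simp: simple_graph_def nsets_def)
    show "E \<subseteq> pairs n" by fact
    have "card (stars E t) = card (stars (edges H) t)"
      unfolding \<phi>(3) by (rule card_stars_image[OF \<phi>(2) sub t(1)])
    thus "?EQ (\<lambda>G. f (overlay E G)) = \<mu>"
      unfolding f_def using expectation_star_overlay[OF p t(1) \<phi>(4)] by (simp add: \<mu>_def l_def)
    show "l ^ t * (\<Sum>v\<in>{1..n}. real (card {e \<in> E. v \<in> e}) ^ t) = A"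
      unfolding A_def vdegree_def \<phi>(3)
      by (subst sum_degrees_image[OF \<phi>(2) sub t(1)]) (use \<phi>(1) in auto)
  qed
  have fin: "finite (set_pmf ?copy)" using H by simp
  have EP: "measure_pmf.expectation (planted n p H) f = \<mu>"
  proof -
    have "measure_pmf.expectation (planted n p H) f = measure_pmf.expectation ?copy (\<lambda>_. \<mu>)"
      unfolding expectation_planted[OF H]
      by (intro Bochner_Integration.integral_cong_AE) (auto simp: AE_measure_pmf_iff copyE)
    thus ?thesis by simp
  qed
  have \<Delta>: "\<Delta> = \<mu>" unfolding \<Delta>_def EP EQ0 using mu0 by simp
  show "\<Delta> > 0" using \<Delta> mu0 by simp
  let ?Q = "K ^ T / R\<^sup>2 + 1 / K"
  \<comment> \<open>used with \<open>a = A\<close> for the planted copies and \<open>a = 0\<close> for the null model\<close>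
  have bound: "C ^ (2 * t) * (real (t + 2) * (K ^ t * real n ^ (t + 1) + a\<^sup>2 / K)) \<le> separation_const C T * ?Q * \<Delta>\<^sup>2"
    if a: "a\<^sup>2 \<le> A\<^sup>2" for a
  proof -
    have n2: "real n ^ (t + 1) = A\<^sup>2 / R\<^sup>2"
    proof -
      have "real n ^ (t + 1) = (N ^ (t + 1))\<^sup>2"
        by (simp only: N(2)[symmetric] power_mult[symmetric] mult.commute)
      thus ?thesis unfolding AR using R1 by (simp add: power_mult_distrib)
    qed
    have "K ^ t * real n ^ (t + 1) + a\<^sup>2 / K \<le> K ^ T * (A\<^sup>2 / R\<^sup>2) + A\<^sup>2 / K"
      unfolding n2 using K t a
      by (intro add_mono mult_right_mono power_increasing divide_right_mono) auto
    also have "\<dots> = A\<^sup>2 * ?Q" by (simp add: algebra_simps)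
    finally have 1: "K ^ t * real n ^ (t + 1) + a\<^sup>2 / K \<le> A\<^sup>2 * ?Q" .
    have Q0: "0 \<le> ?Q" using K by simp
    have "A\<^sup>2 \<le> (4 * real T ^ T * \<mu>)\<^sup>2" using Amu A0 by (intro power_mono) auto
    hence "A\<^sup>2 * ?Q \<le> (4 * real T ^ T * \<mu>)\<^sup>2 * ?Q" using Q0 by (rule mult_right_mono)
    with 1 have 2: "K ^ t * real n ^ (t + 1) + a\<^sup>2 / K \<le> (4 * real T ^ T * \<mu>)\<^sup>2 * ?Q" by linarith
    have "C ^ (2 * t) * (real (t + 2) * (K ^ t * real n ^ (t + 1) + a\<^sup>2 / K))
        \<le> C ^ (2 * T) * (real (T + 2) * ((4 * real T ^ T * \<mu>)\<^sup>2 * ?Q))"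
      using C t 2 K by (intro mult_mono power_increasing) auto
    also have "\<dots> = separation_const C T * ?Q * \<mu>\<^sup>2"
    proof -
      have "c * (u * ((4 * x * m)\<^sup>2 * q)) = 16 * x\<^sup>2 * c * u * q * m\<^sup>2" for c u x m q :: real
        by (simp add: power2_eq_square)
      thus ?thesis unfolding separation_const_def .
    qed
    finally show ?thesis unfolding \<Delta> .
  qed
  have "measure_pmf.expectation (planted n p H) (\<lambda>G. (f G)\<^sup>2) \<le> separation_const C T * ?Q * \<Delta>\<^sup>2 + \<mu>\<^sup>2"
    unfolding expectation_planted[OF H]
  proof (rule prob_space.integral_le_const[OF measure_pmf.prob_space_axioms
        integrable_measure_pmf_finite[OF fin]], rule AE_pmfI)
    fix E assume E: "E \<in> set_pmf ?copy"
    have "?EQ (\<lambda>G. (f (overlay E G))\<^sup>2) - (?EQ (\<lambda>G. f (overlay E G)))\<^sup>2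
        \<le> C ^ (2 * t) * (real (t + 2) * (K ^ t * real n ^ (t + 1) + A\<^sup>2 / K))"
      using conditional_variance_star_le[OF p t(1) copyE(2)[OF E] C K]
      by (simp only: f_def copyE(3)[OF E, unfolded l_def])
    also have "\<dots> \<le> separation_const C T * ?Q * \<Delta>\<^sup>2" by (rule bound) simp
    finally show "?EQ (\<lambda>G. (f (overlay E G))\<^sup>2) \<le> separation_const C T * ?Q * \<Delta>\<^sup>2 + \<mu>\<^sup>2"
      unfolding copyE(1)[OF E] by simp
  qed
  thus "measure_pmf.variance (planted n p H) f \<le> separation_const C T * ?Q * \<Delta>\<^sup>2"
    using H by (subst variance_finite_support) (simp_all add: EP)
  have "measure_pmf.variance (erdos_renyi n p) f
      \<le> C ^ (2 * t) * (real (t + 2) * (K ^ t * real n ^ (t + 1) + 0\<^sup>2 / K))"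
    using conditional_variance_star_le[OF p t(1) empty_subsetI C K] zero_power[of t, where 'a = real] t
    by (subst variance_finite_support) (simp_all add: f_def)
  also have "\<dots> \<le> separation_const C T * ?Q * \<Delta>\<^sup>2" by (rule bound) simp
  finally show "measure_pmf.variance (erdos_renyi n p) f \<le> separation_const C T * ?Q * \<Delta>\<^sup>2" .
qed

lemma signed_star_count_polynomial:
  assumes t: "1 \<le> t" "t \<le> D"
  obtains g where "mpoly_vars g \<subseteq> pairs n" "mpoly_degree g \<le> D"
    "poly_fun g = signed_count n p (star_graph t)"
proof -
  let ?s = "sqrt (p * (1 - p))"
  have eq: "signed_count n p (star_graph t)
      = (\<lambda>G. \<Sum>S\<in>stars (pairs n) t. \<Prod>e\<in>S. - (p / ?s) + (1 / ?s) * of_bool (G e))"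
    by (rule ext) (simp add: signed_count_star[OF t(1)] fchar_def diff_divide_distrib)
  have "signed_count n p (star_graph t) \<in> multilinear_span (\<lambda>e G. of_bool (G e)) n D"
    unfolding eq
  proof (intro multilinear_span_sum multilinear_span_prod_affine)
    fix S assume "S \<in> stars (pairs n) t"
    thus "S \<in> small_edge_sets n D" using t by (auto simp: stars_def small_edge_sets_def)
  qed (simp add: finite_stars)
  thus ?thesis using polynomial_of_multilinear that by blast
qed

lemma eventually_edge_signal_le:
  assumes p: "\<And>n. 0 < p n \<and> p n < 1" and lim: "liminf (\<lambda>n. ereal (p n)) > 0"
  obtains C where "1 \<le> C" "\<forall>\<^sub>F n in sequentially. edge_signal (p n) \<le> C"
proof -
  obtain c where c: "0 < ereal c" "ereal c < liminf (\<lambda>n. ereal (p n))"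
    using ereal_dense2[OF lim] by blast
  have "\<forall>\<^sub>F n in sequentially. ereal c < ereal (p n)" by (rule less_LiminfD[OF c(2)])
  hence "\<forall>\<^sub>F n in sequentially. edge_signal (p n) \<le> max 1 (sqrt (1 / c))"
  proof eventually_elim
    case (elim n)
    have "(1 - p n) / p n \<le> 1 / c" using elim c(1) p[of n] by (intro frac_le) auto
    hence "edge_signal (p n) \<le> sqrt (1 / c)" unfolding edge_signal_def by (rule real_sqrt_le_mono)
    thus ?case by simp
  qed
  thus ?thesis by (intro that[of "max 1 (sqrt (1 / c))"]) simp_all
qed

lemma strongly_separatesI:
  assumes "\<And>\<epsilon>::real. 0 < \<epsilon> \<Longrightarrow> \<forall>\<^sub>F n in sequentially.
     0 < \<bar>measure_pmf.expectation (P n) (f n) - measure_pmf.expectation (Q n) (f n)\<bar> \<and>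
     measure_pmf.variance (P n) (f n) \<le> \<epsilon> *
       \<bar>measure_pmf.expectation (P n) (f n) - measure_pmf.expectation (Q n) (f n)\<bar>\<^sup>2 \<and>
     measure_pmf.variance (Q n) (f n) \<le> \<epsilon> *
       \<bar>measure_pmf.expectation (P n) (f n) - measure_pmf.expectation (Q n) (f n)\<bar>\<^sup>2"
  shows "strongly_separates P Q f"
proof -
  define b where "b n = \<bar>measure_pmf.expectation (P n) (f n) - measure_pmf.expectation (Q n) (f n)\<bar>" for n
  define vP where "vP n = measure_pmf.variance (P n) (f n)" for n
  define vQ where "vQ n = measure_pmf.variance (Q n) (f n)" for n
  note * = assms[folded b_def vP_def vQ_def]
  have "\<forall>\<^sub>F n in sequentially. b n \<noteq> 0"
    using *[OF zero_less_one] by (rule eventually_mono) auto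
  moreover have "(\<lambda>n. max (sqrt (vP n)) (sqrt (vQ n)) / b n) \<longlonglongrightarrow> 0"
  proof (rule tendstoI)
    fix \<epsilon> :: real assume \<epsilon>: "0 < \<epsilon>"
    have "0 < (\<epsilon> / 2)\<^sup>2" using \<epsilon> by simp
    from *[OF this] show "\<forall>\<^sub>F n in sequentially. dist (max (sqrt (vP n)) (sqrt (vQ n)) / b n) 0 < \<epsilon>"
    proof eventually_elim
      case (elim n)
      hence b: "0 < b n" by blast
      have v: "vP n \<le> (\<epsilon> / 2 * b n)\<^sup>2" "vQ n \<le> (\<epsilon> / 2 * b n)\<^sup>2"
        using elim by (simp_all only: power_mult_distrib)
      have "sqrt (vP n) \<le> \<epsilon> / 2 * b n" "sqrt (vQ n) \<le> \<epsilon> / 2 * b n"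
        using \<epsilon> b by (intro real_le_lsqrt v; simp)+
      hence "max (sqrt (vP n)) (sqrt (vQ n)) \<le> \<epsilon> / 2 * b n" by simp
      hence "max (sqrt (vP n)) (sqrt (vQ n)) / b n \<le> \<epsilon> / 2" using b by (simp add: pos_divide_le_eq)
      moreover have "0 \<le> vP n" unfolding vP_def by (intro Bochner_Integration.integral_nonneg) simp
      hence "0 \<le> max (sqrt (vP n)) (sqrt (vQ n)) / b n" using b by (simp add: le_max_iff_disj)
      ultimately show ?case unfolding dist_real_def using \<epsilon> by linarith
    qed
  qed
  ultimately show ?thesis
    unfolding strongly_separates_def Let_def b_def vP_def vQ_def by blast
qed

section \<open>The equivalence\<close>

text \<open>First \<open>K\<close> is fixed so that \<open>1 / K\<close> is small, then \<open>n\<close> is taken so large that \<open>K ^ T / R\<^sup>2\<close> is small and \<open>K \<le> n\<close>.\<close>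

lemma star_counts_strongly_separate:
  fixes H :: "nat \<Rightarrow> 'a ugraph" and p :: "nat \<Rightarrow> real" and ts :: "nat \<Rightarrow> nat"
  assumes H: "\<And>n. simple_graph (H n)" "\<And>n. card (verts (H n)) \<le> n"
    and p: "\<And>n. 0 < p n \<and> p n < 1" and C: "1 \<le> C" "\<forall>\<^sub>F n in sequentially. edge_signal (p n) \<le> C"
    and ts: "\<And>n. 1 \<le> ts n" "\<And>n. ts n \<le> T"
    and lim: "filterlim (\<lambda>n. star_ratio n (p n) (H n) (ts n)) at_top sequentially"
  shows "strongly_separates (\<lambda>n. planted n (p n) (H n)) (\<lambda>n. erdos_renyi n (p n))
           (\<lambda>n. signed_count n (p n) (star_graph (ts n)))"
proof (rule strongly_separatesI)
  fix \<epsilon> :: real assume \<epsilon>: "0 < \<epsilon>"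
  define L where "L = separation_const C T"
  \<comment> \<open>each of the two error terms gets \<open>\<epsilon> / 2\<close>\<close>
  define K where "K = 2 * L / \<epsilon> + 1"
  define R0 where "R0 = max (2 * (real T * C) ^ T) (2 * L * K ^ T / \<epsilon> + 1)"
  have L0: "0 \<le> L" unfolding L_def separation_const_def using C by simp
  have K1: "1 \<le> K" using L0 \<epsilon> by (simp add: K_def)
  have big: "\<forall>\<^sub>F n in sequentially. K \<le> real n"
    using filterlim_real_sequentially by (simp add: filterlim_at_top)
  have ratio: "\<forall>\<^sub>F n in sequentially. R0 \<le> star_ratio n (p n) (H n) (ts n)"
    using lim by (simp add: filterlim_at_top)
  let ?b = "\<lambda>n. \<bar>measure_pmf.expectation (planted n (p n) (H n)) (signed_count n (p n) (star_graph (ts n)))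
       - measure_pmf.expectation (erdos_renyi n (p n)) (signed_count n (p n) (star_graph (ts n)))\<bar>"
  show "\<forall>\<^sub>F n in sequentially. 0 < ?b n \<and>
      measure_pmf.variance (planted n (p n) (H n)) (signed_count n (p n) (star_graph (ts n))) \<le> \<epsilon> * (?b n)\<^sup>2 \<and>
      measure_pmf.variance (erdos_renyi n (p n)) (signed_count n (p n) (star_graph (ts n))) \<le> \<epsilon> * (?b n)\<^sup>2"
    using C(2) big ratio
  proof eventually_elim
    case (elim n)
    define R where "R = star_ratio n (p n) (H n) (ts n)"
    have R: "2 * (real T * C) ^ T \<le> R" "2 * L * K ^ T / \<epsilon> + 1 \<le> R"
      using elim(3) by (simp_all add: R_def R0_def)
    have pn: "0 < p n" "p n < 1" using p by auto
    note sep = star_count_separation[OF pn H(1) H(2) elim(1) C(1) K1 elim(2) ts(1) ts(2) R(1)[unfolded R_def],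
        folded R_def L_def]
    have "L * (K ^ T / R\<^sup>2 + 1 / K) \<le> \<epsilon>"
    proof -
      have "0 \<le> 2 * L * K ^ T / \<epsilon>" using L0 K1 \<epsilon> by simp
      hence R1: "1 \<le> R" "2 * L * K ^ T / \<epsilon> \<le> R" using R(2) by linarith+
      have "R * 1 \<le> R * R" using R1 by (intro mult_left_mono) auto
      hence "2 * L * K ^ T / \<epsilon> \<le> R\<^sup>2" using R1 unfolding power2_eq_square by linarith
      hence "2 * L * K ^ T \<le> R\<^sup>2 * \<epsilon>" using \<epsilon> by (simp only: pos_divide_le_eq)
      hence "L * K ^ T \<le> \<epsilon> / 2 * R\<^sup>2" by (simp add: algebra_simps)
      moreover have "0 < R\<^sup>2" using R1 by simp
      ultimately have "L * K ^ T / R\<^sup>2 \<le> \<epsilon> / 2" by (simp only: pos_divide_le_eq)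
      moreover have "L / K \<le> \<epsilon> / 2"
      proof -
        have "2 * L / \<epsilon> \<le> K" by (simp add: K_def)
        hence "L \<le> \<epsilon> / 2 * K" using \<epsilon> by (simp add: pos_divide_le_eq mult.commute)
        moreover have "0 < K" using K1 by simp
        ultimately show ?thesis by (simp only: pos_divide_le_eq)
      qed
      moreover have "L * (K ^ T / R\<^sup>2 + 1 / K) = L * K ^ T / R\<^sup>2 + L / K"
        by (simp add: distrib_left)
      ultimately show ?thesis by linarith
    qed
    hence "L * (K ^ T / R\<^sup>2 + 1 / K) * (?b n)\<^sup>2 \<le> \<epsilon> * (?b n)\<^sup>2"
      by (rule mult_right_mono) simp
    thus ?case using sep by (meson order.trans)
  qed
qed

text \<open>If all ratios are at most \<open>Z\<close>, the advantage is at most a constant \<open>B\<close>.  Once the null standard deviation is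
  below \<open>\<epsilon>\<close> times the difference of means with \<open>\<epsilon>\<^sup>2 * B < 1\<close>, this contradicts Cauchy--Schwarz.\<close>

lemma separation_imp_star_ratio_large:
  fixes H :: "nat \<Rightarrow> 'a ugraph" and p :: "nat \<Rightarrow> real" and f :: "nat \<Rightarrow> nat set mpoly"
  assumes H: "\<And>n. simple_graph (H n)" "\<And>n. card (verts (H n)) \<le> n"
    and p: "\<And>n. 0 < p n \<and> p n < 1" and C: "1 \<le> C" "\<forall>\<^sub>F n in sequentially. edge_signal (p n) \<le> C"
    and D: "\<And>n. 1 \<le> D n" "\<And>n. D n \<le> T"
    and f: "\<And>n. mpoly_vars (f n) \<subseteq> pairs n" "\<And>n. mpoly_degree (f n) \<le> D n"
    and sep: "strongly_separates (\<lambda>n. planted n (p n) (H n)) (\<lambda>n. erdos_renyi n (p n)) (\<lambda>n. poly_fun (f n))"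
  shows "filterlim (\<lambda>n. MAX t\<in>{1..D n}. star_ratio n (p n) (H n) t) at_top sequentially"
  unfolding filterlim_at_top
proof
  fix Z :: real
  define M where "M = max 1 Z"
  define B where "B = (\<Sum>d\<le>T. advantage_const C d * (M ^ d)\<^sup>2)"
  \<comment> \<open>chosen so that \<open>\<epsilon>\<^sup>2 * B < 1\<close>\<close>
  define \<epsilon> where "\<epsilon> = 1 / (B + 1)"
  have adv0: "0 \<le> advantage_const C d * (M ^ d)\<^sup>2" for d
    using C by (simp add: advantage_const_def)
  have B0: "0 \<le> B" unfolding B_def by (intro sum_nonneg adv0)
  have \<epsilon>0: "0 < \<epsilon>" using B0 by (simp add: \<epsilon>_def)
  have \<epsilon>B: "\<epsilon>\<^sup>2 * B < 1"
  proof -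
    have "\<epsilon> * B < 1" using B0 by (simp add: \<epsilon>_def)
    moreover have "\<epsilon> \<le> 1" using B0 by (simp add: \<epsilon>_def)
    hence "\<epsilon> * (\<epsilon> * B) \<le> 1 * (\<epsilon> * B)" using \<epsilon>0 B0 by (intro mult_right_mono) auto
    ultimately show ?thesis by (simp add: power2_eq_square mult.assoc)
  qed
  define b where "b n = \<bar>measure_pmf.expectation (planted n (p n) (H n)) (poly_fun (f n))
       - measure_pmf.expectation (erdos_renyi n (p n)) (poly_fun (f n))\<bar>" for n
  define vP where "vP n = measure_pmf.variance (planted n (p n) (H n)) (poly_fun (f n))" for n
  define vQ where "vQ n = measure_pmf.variance (erdos_renyi n (p n)) (poly_fun (f n))" for n
  have nz: "\<forall>\<^sub>F n in sequentially. b n \<noteq> 0"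
    and small: "(\<lambda>n. max (sqrt (vP n)) (sqrt (vQ n)) / b n) \<longlonglongrightarrow> 0"
    using sep unfolding strongly_separates_def Let_def b_def vP_def vQ_def by auto
  have ev: "\<forall>\<^sub>F n in sequentially. max (sqrt (vP n)) (sqrt (vQ n)) / b n < \<epsilon>"
    using order_tendstoD(2)[OF small \<epsilon>0] .
  show "\<forall>\<^sub>F n in sequentially. Z \<le> (MAX t\<in>{1..D n}. star_ratio n (p n) (H n) t)"
    using nz ev C(2) eventually_gt_at_top[of 0]
  proof eventually_elim
    case (elim n)
    show ?case
    proof (rule ccontr)
      assume neg: "\<not> Z \<le> (MAX t\<in>{1..D n}. star_ratio n (p n) (H n) t)"
      have R: "star_ratio n (p n) (H n) t \<le> M" if t: "1 \<le> t" "t \<le> D n" for t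
      proof -
        have "star_ratio n (p n) (H n) t \<le> (MAX t\<in>{1..D n}. star_ratio n (p n) (H n) t)"
          using t by (intro Max_ge) auto
        thus ?thesis using neg by (simp add: M_def)
      qed
      have pn: "0 < p n" "p n < 1" using p by auto
      let ?adv = "\<Sum>S\<in>small_edge_sets n (D n) - {{}}.
        (measure_pmf.expectation (planted n (p n) (H n)) (fchar (p n) S))\<^sup>2"
      have "?adv \<le> advantage_const C (D n) * (M ^ D n)\<^sup>2"
        by (rule advantage_bound[OF pn H(1) H(2) elim(4) elim(3) C(1) _ R]) (simp_all add: M_def)
      also have "\<dots> \<le> B"
        unfolding B_def using D(2)[of n] adv0 by (intro member_le_sum) auto
      finally have adv: "?adv \<le> B" .
      have v0: "0 \<le> vQ n" unfolding vQ_def by (intro Bochner_Integration.integral_nonneg) simp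
      have b0: "0 < b n" using elim(1) by (simp add: b_def)
      have "(b n)\<^sup>2 \<le> vQ n * ?adv"
        unfolding b_def vQ_def power2_abs
        by (rule low_degree_advantage[OF pn H(1) H(2) poly_fun_in_character_span[OF pn f(1) f(2)]])
      also have "\<dots> \<le> vQ n * B" using adv v0 by (rule mult_left_mono)
      also have "\<dots> \<le> (\<epsilon> * b n)\<^sup>2 * B"
      proof (rule mult_right_mono[OF _ B0])
        have "sqrt (vQ n) \<le> max (sqrt (vP n)) (sqrt (vQ n))" by simp
        also have "\<dots> \<le> \<epsilon> * b n" using elim(2) b0 by (simp only: pos_divide_less_eq) 
        finally have "(sqrt (vQ n))\<^sup>2 \<le> (\<epsilon> * b n)\<^sup>2" using v0 by (intro power_mono) auto
        thus "vQ n \<le> (\<epsilon> * b n)\<^sup>2" using v0 by simp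
      qed
      also have "\<dots> = (\<epsilon>\<^sup>2 * B) * (b n)\<^sup>2" by (simp add: power_mult_distrib)
      also have "\<dots> < 1 * (b n)\<^sup>2" using \<epsilon>B b0 by (intro mult_strict_right_mono) auto
      finally show False by simp
    qed
  qed
qed

theorem corollary2p8:
  fixes H :: "nat \<Rightarrow> 'a ugraph" and p :: "nat \<Rightarrow> real" and D :: "nat \<Rightarrow> nat"
  assumes "\<And>n. simple_graph (H n)" and "\<And>n. card (verts (H n)) \<le> n"
    and "\<And>n. 0 < p n \<and> p n < 1" and "liminf (\<lambda>n. ereal (p n)) > 0"
    and "\<And>n. D n \<ge> 1" and "bdd_above (range D)"
  shows
    "((\<exists>f :: nat \<Rightarrow> nat set mpoly.
         (\<forall>n. mpoly_vars (f n) \<subseteq> pairs n \<and> mpoly_degree (f n) \<le> D n) \<and>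
         strongly_separates (\<lambda>n. planted n (p n) (H n)) (\<lambda>n. erdos_renyi n (p n))
           (\<lambda>n. poly_fun (f n)))
      \<longleftrightarrow> filterlim (\<lambda>n. MAX t\<in>{1..D n}. star_ratio n (p n) (H n) t) at_top sequentially)
     \<and>
     (filterlim (\<lambda>n. MAX t\<in>{1..D n}. star_ratio n (p n) (H n) t) at_top sequentially \<longrightarrow>
      (\<forall>ts :: nat \<Rightarrow> nat.
         (\<forall>n. is_arg_max (star_ratio n (p n) (H n)) (\<lambda>t. t \<in> {1..D n}) (ts n)) \<longrightarrow>
         strongly_separates (\<lambda>n. planted n (p n) (H n)) (\<lambda>n. erdos_renyi n (p n))
           (\<lambda>n. signed_count n (p n) (star_graph (ts n)))))"
proof -
  note H = assms(1,2) and p = assms(3)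
  obtain C where C: "1 \<le> C" "\<forall>\<^sub>F n in sequentially. edge_signal (p n) \<le> C"
    using eventually_edge_signal_le[OF assms(3,4)] by blast
  obtain T where T: "\<And>n. D n \<le> T" using assms(6) by (auto simp: bdd_above_def)
  let ?R = "\<lambda>n. MAX t\<in>{1..D n}. star_ratio n (p n) (H n) t"
  have star: "strongly_separates (\<lambda>n. planted n (p n) (H n)) (\<lambda>n. erdos_renyi n (p n))
           (\<lambda>n. signed_count n (p n) (star_graph (ts n)))"
    if lim: "filterlim ?R at_top sequentially"
      and ts: "\<And>n. is_arg_max (star_ratio n (p n) (H n)) (\<lambda>t. t \<in> {1..D n}) (ts n)" for ts
  proof (rule star_counts_strongly_separate[OF H p C])
    have t: "ts n \<in> {1..D n}" for n using ts[of n] by (simp add: is_arg_max_def)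
    show "1 \<le> ts n" "ts n \<le> T" for n using t[of n] T[of n] by auto
    have "?R n \<le> star_ratio n (p n) (H n) (ts n)" for n
      using ts[of n] t[of n] by (intro Max.boundedI) (auto simp: is_arg_max_def not_less)
    thus "filterlim (\<lambda>n. star_ratio n (p n) (H n) (ts n)) at_top sequentially"
      by (intro filterlim_at_top_mono[OF lim] always_eventually allI)
  qed
  have ex: "\<exists>t. is_arg_max (star_ratio n (p n) (H n)) (\<lambda>t. t \<in> {1..D n}) t" for n
  proof -
    have ne: "star_ratio n (p n) (H n) ` {1..D n} \<noteq> {}" using assms(5)[of n] by simp
    have "?R n \<in> star_ratio n (p n) (H n) ` {1..D n}" by (rule Max_in[OF _ ne]) simp
    then obtain t where t: "t \<in> {1..D n}" "?R n = star_ratio n (p n) (H n) t" by blast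
    have "star_ratio n (p n) (H n) s \<le> star_ratio n (p n) (H n) t" if "s \<in> {1..D n}" for s
      unfolding t(2)[symmetric] using that by (intro Max_ge) auto
    thus ?thesis using t(1) by (auto simp: is_arg_max_def not_less intro!: exI[of _ t])
  qed
  have suff: "\<exists>f :: nat \<Rightarrow> nat set mpoly.
         (\<forall>n. mpoly_vars (f n) \<subseteq> pairs n \<and> mpoly_degree (f n) \<le> D n) \<and>
         strongly_separates (\<lambda>n. planted n (p n) (H n)) (\<lambda>n. erdos_renyi n (p n)) (\<lambda>n. poly_fun (f n))"
    if lim: "filterlim ?R at_top sequentially"
  proof -
    obtain ts where ts: "\<And>n. is_arg_max (star_ratio n (p n) (H n)) (\<lambda>t. t \<in> {1..D n}) (ts n)"
      using ex by metis
    have "\<exists>g :: nat set mpoly. mpoly_vars g \<subseteq> pairs n \<and> mpoly_degree g \<le> D n \<and>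
        poly_fun g = signed_count n (p n) (star_graph (ts n))" for n
    proof -
      have "1 \<le> ts n" "ts n \<le> D n" using ts[of n] by (auto simp: is_arg_max_def)
      from signed_star_count_polynomial[OF this, of n "p n"] show ?thesis by metis
    qed
    then obtain f :: "nat \<Rightarrow> nat set mpoly" where
      f: "\<And>n. mpoly_vars (f n) \<subseteq> pairs n \<and> mpoly_degree (f n) \<le> D n \<and>
        poly_fun (f n) = signed_count n (p n) (star_graph (ts n))" by metis
    thus ?thesis using star[OF lim ts] by (intro exI[of _ f]) simp
  qed
  have nec: "filterlim ?R at_top sequentially"
    if f: "\<forall>n. mpoly_vars (f n) \<subseteq> pairs n \<and> mpoly_degree (f n) \<le> D n"
      and sep: "strongly_separates (\<lambda>n. planted n (p n) (H n)) (\<lambda>n. erdos_renyi n (p n)) (\<lambda>n. poly_fun (f n))"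
    for f :: "nat \<Rightarrow> nat set mpoly"
    using f by (intro separation_imp_star_ratio_large[OF H p C assms(5) T _ _ sep]) auto
  show ?thesis
  proof (intro conjI iffI impI allI)
    assume "\<exists>f :: nat \<Rightarrow> nat set mpoly.
         (\<forall>n. mpoly_vars (f n) \<subseteq> pairs n \<and> mpoly_degree (f n) \<le> D n) \<and>
         strongly_separates (\<lambda>n. planted n (p n) (H n)) (\<lambda>n. erdos_renyi n (p n)) (\<lambda>n. poly_fun (f n))"
    thus "filterlim ?R at_top sequentially" using nec by (elim exE conjE)
  next
    assume "filterlim ?R at_top sequentially"
    thus "\<exists>f :: nat \<Rightarrow> nat set mpoly.
         (\<forall>n. mpoly_vars (f n) \<subseteq> pairs n \<and> mpoly_degree (f n) \<le> D n) \<and>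
         strongly_separates (\<lambda>n. planted n (p n) (H n)) (\<lambda>n. erdos_renyi n (p n)) (\<lambda>n. poly_fun (f n))"
      by (rule suff)
  next
    fix ts :: "nat \<Rightarrow> nat"
    assume "filterlim ?R at_top sequentially"
      and "\<forall>n. is_arg_max (star_ratio n (p n) (H n)) (\<lambda>t. t \<in> {1..D n}) (ts n)"
    thus "strongly_separates (\<lambda>n. planted n (p n) (H n)) (\<lambda>n. erdos_renyi n (p n))
           (\<lambda>n. signed_count n (p n) (star_graph (ts n)))"
      using star by blast
  qed
qed

end
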